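(* Let $A$, $B$, $\mathbb{X}$, $\mathbb{Y}$ and $\mathbb{Z}$ be positive stable matrices in $\mathbb{C}^{r\times r}$. Then $$\mathfrak{B}_{\mathbb{Y}}^{(A,B)}(\mathbb{X}+I,\mathbb{Z})+\mathfrak{B}_{\mathbb{Y}}^{(A,B)}(\mathbb{X},\mathbb{Z}+I)=\mathfrak{B}_{\mathbb{Y}}^{(A,B)}(\mathbb{X},\mathbb{Z}).$$
   Context: A matrix in $\mathbb{C}^{r\times r}$ is positive stable if all its eigenvalues have positive real part; $I$ is the identity matrix. For $t>0$ and a square matrix $M$, $t^M=\exp(M\ln t)$. The Pochhammer symbol is $(M)_0=I$, $(M)_n=M(M+I)\cdots(M+(n-1)I)$ for $n\ge1$. For positive stable $B$ and a square matrix $W$, ${}_1F_1(A;B;W)=\sum_{n\ge0}(A)_n\,[(B)_n]^{-1}\,\frac{W^n}{n!}$. For positive stable $A,B,\mathbb{X},\mathbb{Y},\mathbb{Z}$ the new extended beta matrix function is $$\mathfrak{B}_{\mathbb{Y}}^{(A,B)}(\mathbb{X},\mathbb{Z})=\int_0^1 {}_1F_1\!\left(A;B;-\frac{\mathbb{Y}}{t(1-t)}\right)t^{\mathbb{X}-I}(1-t)^{\mathbb{Z}-I}\,dt .$$ *)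

theory Defs
  imports "HOL-Analysis.Analysis"
begin

text \<open>
  Matrices in \<open>\<complex>\<^sup>r\<^sup>\<times>\<^sup>r\<close> are elements of \<^typ>\<open>complex^'r^'r\<close>. The matrix product is \<open>**\<close> and the
  identity matrix is \<open>mat 1\<close>. The library operations \<open>*\<close>, \<open>1\<close> and \<open>^\<close> on this type are entrywise,
  so they must not be used here, and \<^const>\<open>exp\<close> is not available.
\<close>

definition matrix_eigenvalue :: "complex^'r^'r \<Rightarrow> complex \<Rightarrow> bool" where
  "matrix_eigenvalue M c \<longleftrightarrow> (\<exists>v. v \<noteq> 0 \<and> M *v v = c *s v)"

definition positive_stable :: "complex^'r^'r \<Rightarrow> bool" where
  "positive_stable M \<longleftrightarrow> (\<forall>c. matrix_eigenvalue M c \<longrightarrow> 0 < Re c)"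

primrec matrix_pow :: "complex^'r^'r \<Rightarrow> nat \<Rightarrow> complex^'r^'r" where
  "matrix_pow M 0 = mat 1"
| "matrix_pow M (Suc n) = M ** matrix_pow M n"

definition matrix_exp :: "complex^'r^'r \<Rightarrow> complex^'r^'r" where
  "matrix_exp M = (\<Sum>n. (1 / fact n) *\<^sub>R matrix_pow M n)"

definition real_matrix_powr :: "real \<Rightarrow> complex^'r^'r \<Rightarrow> complex^'r^'r" where
  "real_matrix_powr t M = matrix_exp (ln t *\<^sub>R M)"

primrec matrix_pochhammer :: "complex^'r^'r \<Rightarrow> nat \<Rightarrow> complex^'r^'r" where
  "matrix_pochhammer M 0 = mat 1"
| "matrix_pochhammer M (Suc n) = matrix_pochhammer M n ** (M + mat (of_nat n))"

text \<open>The matrices involved need not commute, so the order of the factors matters.\<close>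

definition matrix_1F1 :: "complex^'r^'r \<Rightarrow> complex^'r^'r \<Rightarrow> complex^'r^'r \<Rightarrow> complex^'r^'r" where
  "matrix_1F1 A B W =
     (\<Sum>n. (1 / fact n) *\<^sub>R
        (matrix_pochhammer A n ** matrix_inv (matrix_pochhammer B n) ** matrix_pow W n))"

text \<open>Integrating over the open interval excludes the meaningless values at the endpoints.\<close>

definition extended_beta ::
  "complex^'r^'r \<Rightarrow> complex^'r^'r \<Rightarrow> complex^'r^'r \<Rightarrow> complex^'r^'r \<Rightarrow> complex^'r^'r \<Rightarrow> complex^'r^'r"
where
  "extended_beta A B Y X Z =
     integral {0<..<1} (\<lambda>t::real.
       matrix_1F1 A B (- ((1 / (t * (1 - t))) *\<^sub>R Y)) **
       real_matrix_powr t (X - mat 1) **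
       real_matrix_powr (1 - t) (Z - mat 1))"

end

theory Submission
  imports Defs "HOL-Computational_Algebra.Fundamental_Theorem_Algebra"
begin

text \<open>
  Since \<open>t\<^sup>X = t t\<^sup>X\<^sup>-\<^sup>I\<close>, the integrands of the two terms on the left are \<open>t F(t)\<close> and \<open>(1 - t) F(t)\<close>,
  where \<open>F\<close> is the integrand on the right; the content is that all these integrals converge.
  A positive stable \<open>M\<close> satisfies \<open>H(x, M x) \<ge> c |x|\<^sup>2\<close> for some inner product \<open>H\<close> (Lyapunov), which
  gives \<open>|t\<^sup>X\<^sup>-\<^sup>I| = O(t\<^sup>d\<^sup>-\<^sup>1)\<close> with \<open>d > 0\<close>. Boundedness of \<open>\<^sub>1F\<^sub>1(A; B; - s Y)\<close> for \<open>s \<ge> 0\<close> follows from the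
  confluent hypergeometric equation by an energy estimate with such inner products for \<open>A\<close> and
  \<open>Y\<close>. As \<open>A\<close>, \<open>B\<close>, \<open>Y\<close> need not commute, the equation is set up for the series with
  coefficients \<open>(- Y)\<^sup>n/n! \<otimes> (A)\<^sub>n [(B)\<^sub>n]\<^sup>-\<^sup>1\<close>, on which the three matrices act by commuting operators.
\<close>

section \<open>Lyapunov inner products\<close>

text \<open>The form \<open>H\<close> is left free because the real part of a positive stable matrix
  need not be positive definite for the standard inner product. Boundedness of \<open>H\<close> and
  the lower bound on \<open>H x x\<close> make it equivalent to the norm.\<close>

definition lyapunov_accretive :: "('a::real_inner \<Rightarrow> 'a) \<Rightarrow> bool" where
  "lyapunov_accretive T \<longleftrightarrow> (\<exists>H c. bounded_bilinear H \<and> (\<forall>x y. H x y = H y x) \<and>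
     (\<forall>x. (norm x)\<^sup>2 \<le> H x x) \<and> 0 < c \<and> (\<forall>x. c * (norm x)\<^sup>2 \<le> (H x (T x) :: real)))"

lemma bounded_bilinear_sum:
  fixes f :: "'i \<Rightarrow> 'a::real_normed_vector \<Rightarrow> 'b::real_normed_vector \<Rightarrow> 'c::real_normed_vector"
  assumes "\<And>i. i \<in> I \<Longrightarrow> bounded_bilinear (f i)"
  shows "bounded_bilinear (\<lambda>x y. \<Sum>i\<in>I. f i x y)"
  using assms
proof (induction I rule: infinite_finite_induct)
  case (insert i I)
  interpret f: bounded_bilinear "f i" using insert by auto
  interpret g: bounded_bilinear "\<lambda>x y. \<Sum>i\<in>I. f i x y" using insert by auto
  obtain K L where K: "\<And>x y. norm (f i x y) \<le> norm x * norm y * K"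
    and L: "\<And>x y. norm (\<Sum>i\<in>I. f i x y) \<le> norm x * norm y * L"
    using f.bounded g.bounded by blast
  have "norm (f i x y + (\<Sum>i\<in>I. f i x y)) \<le> norm x * norm y * (K + L)" for x y
    using norm_triangle_mono[OF K L, of x y x y] by (simp add: algebra_simps)
  then have "bounded_bilinear (\<lambda>x y. f i x y + (\<Sum>i\<in>I. f i x y))"
    by (intro bounded_bilinear.intro exI[of _ "K + L"] allI)
      (simp_all only: f.add_left f.add_right g.add_left g.add_right
        f.scaleR_left f.scaleR_right g.scaleR_left g.scaleR_right scaleR_add_right ac_simps)
  then show ?case using insert by simp
qed (auto intro!: bounded_bilinear.intro exI[of _ 0])

text \<open>
  In the form \<open>\<Sum>\<^sub>k e\<^sup>k (N\<^sub>k x \<bullet> N\<^sub>k y)\<close> the weights grow fast enough for each coupling term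
  \<open>N\<^sub>k x \<bullet> N\<^sub>k\<^sub>+\<^sub>1 x\<close> to be absorbed by its two neighbouring squares.
\<close>

lemma lyapunov_accretive_chain:
  fixes T :: "'a::real_inner \<Rightarrow> 'a" and N :: "nat \<Rightarrow> 'a \<Rightarrow> 'a"
  assumes N: "\<And>k. bounded_linear (N k)" and N0: "\<And>x. N 0 x = x" and Nm: "\<And>x. N m x = 0"
    and a: "a > 0"
    and step: "\<And>k x. k < m \<Longrightarrow>
      a * (norm (N k x))\<^sup>2 + N k x \<bullet> N (Suc k) x \<le> N k x \<bullet> N k (T x)"
  shows "lyapunov_accretive T"
proof -
  \<comment> \<open>This value gives \<open>1/(2*a) = e * (a/4)\<close>: the multiple of the next
    square lost to Young's inequality is, after weighting, half of the \<open>a/2\<close> still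
    available at the next level.\<close>
  define e where "e = 2 / a\<^sup>2"
  have e: "e > 0" using a by (simp add: e_def)
  define H where "H x y = (\<Sum>k\<le>m. e^k * (N k x \<bullet> N k y))" for x y
  have "bounded_bilinear (\<lambda>x y. e^k * (N k x \<bullet> N k y))" for k
    using bounded_bilinear.comp[OF bounded_bilinear_inner
        bounded_linear_compose[OF bounded_linear_scaleR_right[of "e^k"] N[of k]] N[of k]]
    by (simp only: inner_scaleR_left)
  then have "bounded_bilinear H"
    unfolding H_def[abs_def] by (intro bounded_bilinear_sum)
  moreover have "H x y = H y x" for x y
    by (simp add: H_def inner_commute)
  moreover have H0: "(norm x)\<^sup>2 \<le> H x x" for x
  proof -
    have "e^0 * (N 0 x \<bullet> N 0 x) \<le> H x x"
      unfolding H_def using e by (intro member_le_sum) auto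
    then show ?thesis by (simp add: N0 power2_norm_eq_inner)
  qed
  moreover have "a/4 * (norm x)\<^sup>2 \<le> H x (T x)" for x
  proof -
    define n where "n k = (norm (N k x))\<^sup>2" for k
    have *: "e^k * (a/2 * n k) - e^Suc k * (a/4 * n (Suc k)) \<le> e^k * (N k x \<bullet> N k (T x))"
      if "k < m" for k
    proof -
      have "- (N k x \<bullet> N (Suc k) x) \<le> norm (N k x) * norm (N (Suc k) x)"
        using Cauchy_Schwarz_ineq2[of "N k x" "N (Suc k) x"] by linarith
      also have "\<dots> \<le> a/2 * n k + 1/(2*a) * n (Suc k)"
      proof -
        have "0 \<le> (a * norm (N k x) - norm (N (Suc k) x))\<^sup>2 / (2*a)" using a by simp
        then show ?thesis using a
          by (simp add: n_def field_simps power2_eq_square)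
      qed
      finally have "a/2 * n k - 1/(2*a) * n (Suc k) \<le> N k x \<bullet> N k (T x)"
        using step[OF that, of x] by (simp add: n_def)
      moreover have "1/(2*a) = e * (a/4)" using a by (simp add: e_def power2_eq_square)
      ultimately have "a/2 * n k - e * (a/4) * n (Suc k) \<le> N k x \<bullet> N k (T x)" by metis
      then have "e^k * (a/2 * n k - e * (a/4) * n (Suc k)) \<le> e^k * (N k x \<bullet> N k (T x))"
        using e by (intro mult_left_mono) auto
      then show ?thesis by (simp add: algebra_simps)
    qed
    have nm: "n m = 0" by (simp add: n_def Nm)
    have "H x (T x) = (\<Sum>k<m. e^k * (N k x \<bullet> N k (T x)))"
      by (simp add: H_def Nm lessThan_Suc_atMost[symmetric])
    also have "\<dots> \<ge> (\<Sum>k<m. e^k * (a/2 * n k) - e^Suc k * (a/4 * n (Suc k)))"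
      using * by (intro sum_mono) auto
    \<comment> \<open>Half of each diagonal term is kept and the other half telescopes against the
      coupling losses, leaving only \<open>n 0\<close> because \<open>n m = 0\<close>.\<close>
    also have "(\<Sum>k<m. e^k * (a/2 * n k) - e^Suc k * (a/4 * n (Suc k))) =
       (\<Sum>k<m. e^k * (a/4 * n k)) + (\<Sum>k<m. e^k * (a/4 * n k) - e^Suc k * (a/4 * n (Suc k)))"
      by (subst sum.distrib[symmetric], rule sum.cong) (auto simp: algebra_simps)
    also have "(\<Sum>k<m. e^k * (a/4 * n k) - e^Suc k * (a/4 * n (Suc k))) = a/4 * n 0"
      by (subst sum_lessThan_telescope') (simp add: nm)
    finally have "(\<Sum>k<m. e^k * (a/4 * n k)) + a/4 * n 0 \<le> H x (T x)" .
    moreover have "0 \<le> (\<Sum>k<m. e^k * (a/4 * n k))"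
      using e a by (intro sum_nonneg) (auto simp: n_def)
    ultimately have "a/4 * n 0 \<le> H x (T x)" by linarith
    then show ?thesis by (simp only: n_def N0)
  qed
  moreover have "a/4 > 0" using a by simp
  ultimately show ?thesis
    unfolding lyapunov_accretive_def by blast
qed

text \<open>The form for \<open>S\<close>, summed over slices on which \<open>T\<close> acts as
  \<open>S\<close>, serves for \<open>T\<close>. This carries a matrix acting on vectors over to its
  action on one index of a matrix or tensor.\<close>

lemma lyapunov_accretive_lift:
  fixes T :: "'a::real_inner \<Rightarrow> 'a" and S :: "'b::real_inner \<Rightarrow> 'b"
  assumes S: "lyapunov_accretive S"
    and \<pi>: "\<And>i. i \<in> I \<Longrightarrow> bounded_linear (\<pi> i)"
    and norm_eq: "\<And>x. (norm x)\<^sup>2 = (\<Sum>i\<in>I. (norm (\<pi> i x))\<^sup>2)"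
    and intertwine: "\<And>i x. i \<in> I \<Longrightarrow> \<pi> i (T x) = S (\<pi> i x)"
  shows "lyapunov_accretive T"
proof -
  obtain H c where H: "bounded_bilinear H" "\<And>x y. H x y = H y x"
     "\<And>x. (norm x)\<^sup>2 \<le> H x x" "0 < c" "\<And>x. c * (norm x)\<^sup>2 \<le> (H x (S x) :: real)"
    using S unfolding lyapunov_accretive_def by blast
  define G where "G x y = (\<Sum>i\<in>I. H (\<pi> i x) (\<pi> i y))" for x y
  have "bounded_bilinear G" unfolding G_def[abs_def]
    by (intro bounded_bilinear_sum bounded_bilinear.comp[OF H(1)] \<pi>)
  moreover have "G x y = G y x" for x y by (auto simp: G_def H(2) intro: sum.cong)
  moreover have "(norm x)\<^sup>2 \<le> G x x" for x
    by (auto simp: G_def norm_eq intro: sum_mono H)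
  moreover have "c * (norm x)\<^sup>2 \<le> G x (T x)" for x
    by (auto simp: G_def norm_eq intertwine sum_distrib_left intro!: sum_mono H)
  ultimately show ?thesis using H(4) unfolding lyapunov_accretive_def by blast
qed

section \<open>Positive stable matrices\<close>

lemma mat_add: "mat (a + b) = mat a + (mat b :: 'a::semiring_1^'n^'n)"
  by (simp add: mat_def vec_eq_iff)

lemma mat_mult_nth: "(mat c ** A) $ i $ j = c * (A $ i $ j :: 'a::comm_semiring_1)"
  by (simp add: matrix_matrix_mult_def mat_def if_distrib if_distribR cong: if_cong)

lemma mult_mat_nth: "(A ** mat c) $ i $ j = c * (A $ i $ j :: 'a::comm_semiring_1)"
  by (simp add: matrix_matrix_mult_def mat_def if_distrib if_distribR mult.commute cong: if_cong)

lemma mat_mult_commute: "mat c ** A = A ** (mat c :: 'a::comm_semiring_1^'n^'n)"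
  by (simp add: vec_eq_iff mat_mult_nth mult_mat_nth)

lemma mat_mult_mat: "mat a ** mat b = (mat (a * b) :: 'a::comm_semiring_1^'n^'n)"
  by (simp add: vec_eq_iff mat_mult_nth) (simp add: mat_def)

lemma mat_mult_vec: "mat c *v x = c *s (x :: 'a::comm_semiring_1^'n)"
  by (simp add: vec_eq_iff matrix_vector_mult_def mat_def if_distrib if_distribR cong: if_cong)

lemma scaleR_eq_mat_mult: "c *\<^sub>R A = mat (of_real c) ** (A :: complex^'n^'n)"
  by (simp add: vec_eq_iff mat_mult_nth scaleR_conv_of_real[where 'a = complex])

lemma linear_matrix_mult_left: "linear (\<lambda>X. A ** X :: complex^'n^'m)"
  by (rule linearI) (simp_all add: vec_eq_iff matrix_matrix_mult_def algebra_simps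
      sum.distrib scaleR_sum_right)

lemma linear_matrix_mult_right: "linear (\<lambda>X. X ** A :: complex^'n^'m)"
  by (rule linearI) (simp_all add: vec_eq_iff matrix_matrix_mult_def algebra_simps
      sum.distrib scaleR_sum_right)

lemmas matrix_mult_add_left = linear_add[OF linear_matrix_mult_right]

lemma linear_matrix_vector_mult: "linear (\<lambda>x. (A :: complex^'n^'m) *v x)"
  by (rule linearI) (simp_all add: vec_eq_iff matrix_vector_mult_def algebra_simps
      sum.distrib scaleR_sum_right)

lemma bounded_bilinear_matrix_mult:
  "bounded_bilinear ((**) :: complex^'k^'m \<Rightarrow> complex^'n^'k \<Rightarrow> complex^'n^'m)"
  using linear_matrix_mult_left linear_matrix_mult_right
  by (auto simp: bilinear_conv_bounded_bilinear[symmetric] bilinear_def)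

section \<open>Polynomials in a matrix and annihilating products of eigenvalue factors\<close>

definition matrix_poly :: "complex^'n^'n \<Rightarrow> complex poly \<Rightarrow> complex^'n^'n" where
  "matrix_poly M p = (\<Sum>i\<le>degree p. mat (coeff p i) ** matrix_pow M i)"

lemma matrix_poly_altdef:
  assumes "degree p \<le> n"
  shows "matrix_poly M p = (\<Sum>i\<le>n. mat (coeff p i) ** matrix_pow M i)"
  unfolding matrix_poly_def
  by (rule sum.mono_neutral_left) (use assms in \<open>auto simp: coeff_eq_0\<close>)

lemma matrix_poly_pCons:
  "matrix_poly M (pCons a q) = mat a + M ** matrix_poly M q"
proof -
  have "matrix_poly M (pCons a q) =
      (\<Sum>i\<le>Suc (degree q). mat (coeff (pCons a q) i) ** matrix_pow M i)"
    by (rule matrix_poly_altdef) (simp add: degree_pCons_le)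
  also have "\<dots> = mat a + (\<Sum>i\<le>degree q. M ** (mat (coeff q i) ** matrix_pow M i))"
    by (subst sum.atMost_Suc_shift)
      (simp add: matrix_mul_assoc mat_mult_commute[of _ M])
  finally show ?thesis
    by (simp add: matrix_poly_def linear_sum[OF linear_matrix_mult_left])
qed

lemma matrix_poly_smult: "matrix_poly M (smult a q) = mat a ** matrix_poly M q"
  by (subst matrix_poly_altdef[of _ "degree q"])
    (simp_all add: degree_smult_le matrix_poly_def linear_sum[OF linear_matrix_mult_left]
      mat_mult_mat[symmetric] matrix_mul_assoc)

lemma matrix_poly_add: "matrix_poly M (p + q) = matrix_poly M p + matrix_poly M q"
proof -
  let ?n = "max (degree p) (degree q)"
  show ?thesis
    by (simp add: matrix_poly_altdef[of p ?n] matrix_poly_altdef[of q ?n]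
        matrix_poly_altdef[of "p + q" ?n] degree_add_le mat_add
        matrix_mult_add_left sum.distrib)
qed

lemma matrix_poly_linear_mult:
  "matrix_poly M ([:- c, 1:] * q) = (M - mat c) ** matrix_poly M q"
proof -
  have "[:- c, 1:] * q = smult (- c) q + pCons 0 q" by simp
  moreover have "mat (- c) + M = M - mat c" by (simp add: mat_def vec_eq_iff)
  ultimately show ?thesis
    by (simp only: matrix_poly_add matrix_poly_smult matrix_poly_pCons mat_0 add_0
        matrix_mult_add_left[symmetric])
qed

text \<open>One more power than the real dimension of the matrix space forces a relation: either two
  powers coincide, giving a difference of monomials, or the powers are linearly dependent. The split
  is made because \<open>dependent\<close> speaks of a set, in which repeated powers
  collapse.\<close>

lemma exists_annihilating_poly:
  fixes M :: "complex^'n^'n"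
  obtains p where "p \<noteq> 0" "matrix_poly M p = 0"
proof (cases "inj_on (matrix_pow M) {..DIM(complex^'n^'n)}")
  case False
  then obtain i j where ij: "i \<noteq> j" "matrix_pow M i = matrix_pow M j"
    by (auto simp: inj_on_def)
  have mono: "matrix_poly M (monom c k) = mat c ** matrix_pow M k" for c k
  proof -
    have "matrix_poly M (monom c k) = (\<Sum>i\<le>k. mat (coeff (monom c k) i) ** matrix_pow M i)"
      by (rule matrix_poly_altdef) (rule degree_monom_le)
    also have "\<dots> = (\<Sum>i\<in>{k}. mat (coeff (monom c k) i) ** matrix_pow M i)"
      by (rule sum.mono_neutral_right) auto
    finally show ?thesis by simp
  qed
  have "matrix_poly M (monom 1 i + monom (-1) j) = mat (1 + -1) ** matrix_pow M j"
    unfolding matrix_poly_add mono ij(2) mat_add matrix_mult_add_left ..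
  moreover have "coeff (monom (1::complex) i + monom (-1) j) i \<noteq> 0"
    using ij(1) by simp
  ultimately show ?thesis using that[of "monom 1 i + monom (-1) j"]
    by (metis coeff_0 add.right_inverse mat_0 linear_0[OF linear_matrix_mult_right])
next
  case True
  let ?S = "matrix_pow M ` {..DIM(complex^'n^'n)}"
  have "card ?S > DIM(complex^'n^'n)" using card_image[OF True] by simp
  then have "dependent ?S" using independent_bound[of ?S] by linarith
  then obtain u v where u: "v \<in> ?S" "u v \<noteq> 0" "(\<Sum>v\<in>?S. u v *\<^sub>R v) = 0"
    by (auto simp: dependent_finite)
  define p where "p = (\<Sum>i\<le>DIM(complex^'n^'n). monom (complex_of_real (u (matrix_pow M i))) i)"
  have coeff: "coeff p i = (if i \<le> DIM(complex^'n^'n) then of_real (u (matrix_pow M i)) else 0)" for i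
    by (simp add: p_def coeff_sum)
  have "degree p \<le> DIM(complex^'n^'n)" by (rule degree_le) (simp add: coeff)
  then have "matrix_poly M p = (\<Sum>i\<le>DIM(complex^'n^'n). mat (coeff p i) ** matrix_pow M i)"
    by (rule matrix_poly_altdef)
  also have "\<dots> = (\<Sum>i\<le>DIM(complex^'n^'n). u (matrix_pow M i) *\<^sub>R matrix_pow M i)"
    by (rule sum.cong) (simp_all add: coeff scaleR_eq_mat_mult)
  also have "\<dots> = 0" using u(3) unfolding sum.reindex[OF True] o_def .
  finally have "matrix_poly M p = 0" .
  moreover have "p \<noteq> 0" using u(1,2) coeff by (metis coeff_0 imageE atMost_iff of_real_eq_0_iff)
  ultimately show ?thesis using that by blast
qed

text \<open>These partial products become the maps \<open>N k\<close> of the Lyapunov chain, where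
  each is obtained from the previous one by a further factor on the left.\<close>

primrec linear_factors :: "complex^'n^'n \<Rightarrow> (nat \<Rightarrow> complex) \<Rightarrow> nat \<Rightarrow> complex^'n^'n" where
  "linear_factors M l 0 = mat 1"
| "linear_factors M l (Suc k) = (M - mat (l k)) ** linear_factors M l k"

lemma linear_factors_cong:
  "(\<And>k. k < n \<Longrightarrow> l k = l' k) \<Longrightarrow> linear_factors M l n = linear_factors M l' n"
  by (induction n) auto

lemma linear_factors_commute: "M ** linear_factors M l k = linear_factors M l k ** M"
proof (induction k)
  case (Suc k)
  have "M ** (M - mat c) = (M - mat c) ** M" for c
    by (simp add: linear_diff[OF linear_matrix_mult_left] linear_diff[OF linear_matrix_mult_right]
        mat_mult_commute)
  then show ?case using Suc by (metis linear_factors.simps(2) matrix_mul_assoc)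
qed simp

lemma matrix_poly_factorisation:
  fixes M :: "complex^'n^'n"
  assumes "p \<noteq> 0"
  shows "\<exists>l n c. c \<noteq> 0 \<and> matrix_poly M p = mat c ** linear_factors M l n \<and>
           (\<forall>k<n. poly p (l k) = 0)"
  using assms
proof (induction "degree p" arbitrary: p)
  case 0
  then obtain a where "p = [:a:]" by (metis degree_eq_zeroE)
  with 0 show ?case
    by (intro exI[of _ "\<lambda>_. 0"] exI[of _ 0] exI[of _ a]) (simp add: matrix_poly_def)
next
  case (Suc d)
  then have "\<not> constant (poly p)" by (simp add: constant_degree)
  then obtain z where "poly p z = 0" using fundamental_theorem_of_algebra by blast
  then obtain q where q: "p = [:- z, 1:] * q" by (auto simp: poly_eq_0_iff_dvd dvd_def)
  with Suc have "q \<noteq> 0" by auto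
  then have "degree p = Suc (degree q)" unfolding q by (subst degree_mult_eq) auto
  with Suc \<open>q \<noteq> 0\<close> obtain l n c where
    IH: "c \<noteq> 0" "matrix_poly M q = mat c ** linear_factors M l n" "\<forall>k<n. poly q (l k) = 0"
    by (metis Suc_inject)
  \<comment> \<open>The root just split off goes to index \<open>n\<close>, past those of
    \<open>q\<close>, so it becomes the leftmost factor and the earlier product is
    unchanged.\<close>
  let ?l = "l(n := z)"
  have "linear_factors M ?l n = linear_factors M l n" by (rule linear_factors_cong) auto
  then have "matrix_poly M p = mat c ** linear_factors M ?l (Suc n)"
    by (simp add: q matrix_poly_linear_mult IH(2) matrix_mul_assoc mat_mult_commute[of _ "M - mat z"]
        del: mult_pCons_left)
  moreover have "\<forall>k<Suc n. poly p (?l k) = 0" using IH(3) by (auto simp: q)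
  ultimately show ?case using IH(1) by blast
qed

text \<open>An annihilating polynomial \<open>p\<close> of least degree is factored completely. For
  a root \<open>z\<close>, the cofactor \<open>q\<close> has smaller degree, so
  \<open>matrix_poly M q\<close> is nonzero, and each nonzero vector in its range is an eigenvector
  for \<open>z\<close>.\<close>

lemma annihilating_eigenvalue_product:
  fixes M :: "complex^'n^'n"
  obtains l n where "linear_factors M l n = 0" "\<And>k. k < n \<Longrightarrow> matrix_eigenvalue M (l k)"
proof -
  define P where "P p \<longleftrightarrow> p \<noteq> 0 \<and> matrix_poly M p = 0" for p
  obtain p0 where "P p0" using exists_annihilating_poly unfolding P_def by metis
  then obtain p where p: "P p" and min: "\<And>q. P q \<Longrightarrow> degree p \<le> degree q"
    by (metis arg_min_natI arg_min_nat_le)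
  have eigen: "matrix_eigenvalue M z" if "poly p z = 0" for z
  proof -
    from that have "[:- z, 1:] dvd p" by (simp add: poly_eq_0_iff_dvd)
    then obtain q where q: "p = [:- z, 1:] * q" by (elim dvdE)
    with p have "q \<noteq> 0" by (auto simp: P_def)
    then have "degree p = Suc (degree q)" unfolding q by (subst degree_mult_eq) auto
    with min[of q] have "\<not> P q" by auto
    with \<open>q \<noteq> 0\<close> have "matrix_poly M q \<noteq> 0" by (simp add: P_def)
    then obtain u where u: "matrix_poly M q *v u \<noteq> 0"
      by (metis matrix_eq matrix_vector_mult_0)
    have "(M - mat z) *v (matrix_poly M q *v u) = 0"
      using p unfolding P_def q matrix_poly_linear_mult by (metis matrix_vector_mul_assoc matrix_vector_mult_0)
    then show ?thesis unfolding matrix_eigenvalue_def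
      using u by (auto simp: matrix_vector_mult_diff_rdistrib mat_mult_vec)
  qed
  obtain l n c where l: "c \<noteq> 0" "matrix_poly M p = mat c ** linear_factors M l n"
    "\<forall>k<n. poly p (l k) = 0"
    using matrix_poly_factorisation p unfolding P_def by blast
  have "linear_factors M l n = mat (1 / c) ** (mat c ** linear_factors M l n)"
    using l(1) by (simp add: matrix_mul_assoc mat_mult_mat)
  also have "\<dots> = 0" using l(2) p by (simp add: P_def)
  finally show ?thesis using that l eigen by blast
qed

text \<open>The inner product here is the real part of the Hermitian one, so the imaginary part of
  \<open>c\<close> drops out. Through this, positivity of the real parts of eigenvalues
  suffices.\<close>

lemma inner_vector_smult: "x \<bullet> (c *s x) = Re c * (norm (x :: complex^'n))\<^sup>2"
proof -
  have "x $ i \<bullet> (c * x $ i) = Re c * (x $ i \<bullet> x $ i)" for i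
    by (simp add: inner_complex_def algebra_simps)
  then show ?thesis
    by (simp add: power2_norm_eq_inner inner_vec_def sum_distrib_left)
qed

text \<open>The chain consists of the products \<open>linear_factors M l k\<close>. They commute
  with \<open>M\<close>, so the k-th one maps \<open>M *v x\<close> to \<open>l k\<close> times the
  k-th value plus the next value, and \<open>Re (l k)\<close> has a positive lower bound
  \<open>a\<close>.\<close>

lemma lyapunov_accretive_positive_stable:
  fixes M :: "complex^'n^'n"
  assumes "positive_stable M"
  shows "lyapunov_accretive ((*v) M)"
proof -
  obtain l m where l: "linear_factors M l m = 0" "\<And>k. k < m \<Longrightarrow> matrix_eigenvalue M (l k)"
    using annihilating_eigenvalue_product by blast
  have pos: "0 < Re (l k)" if "k < m" for k
    using assms l(2)[OF that] by (auto simp: positive_stable_def)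
  \<comment> \<open>The inserted \<open>1\<close> keeps \<open>Min\<close> meaningful when
    \<open>m = 0\<close>.\<close>
  define a where "a = Min (insert 1 ((\<lambda>k. Re (l k)) ` {..<m}))"
  have a: "a > 0" "\<And>k. k < m \<Longrightarrow> a \<le> Re (l k)"
    using pos by (auto simp: a_def)
  show ?thesis
  proof (rule lyapunov_accretive_chain[where N = "\<lambda>k x. linear_factors M l k *v x" and m = m and a = a])
    fix k x assume k: "k < m"
    let ?N = "\<lambda>k. linear_factors M l k *v x"
    have "linear_factors M l k *v (M *v x) = M *v ?N k"
      by (simp add: matrix_vector_mul_assoc linear_factors_commute)
    also have "\<dots> = l k *s ?N k + ?N (Suc k)"
      by (simp add: matrix_vector_mul_assoc[symmetric] matrix_vector_mult_diff_rdistrib mat_mult_vec)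
    finally show "a * (norm (?N k))\<^sup>2 + ?N k \<bullet> ?N (Suc k) \<le> ?N k \<bullet> (linear_factors M l k *v (M *v x))"
      using mult_right_mono[OF a(2)[OF k], of "(norm (?N k))\<^sup>2"]
      by (simp add: inner_right_distrib inner_vector_smult)
  qed (use a l linear_matrix_vector_mult in \<open>auto simp: linear_conv_bounded_linear\<close>)
qed

section \<open>Vector-valued power series and linear equations\<close>

text \<open>The variable is real because each matrix function is followed along a ray, with the
  direction matrix put into the coefficients.\<close>

definition entire_coeffs :: "(nat \<Rightarrow> 'a::real_normed_vector) \<Rightarrow> bool" where
  "entire_coeffs c \<longleftrightarrow> (\<forall>s::real. summable (\<lambda>n. s^n *\<^sub>R c n))"

definition power_series :: "(nat \<Rightarrow> 'a::real_normed_vector) \<Rightarrow> real \<Rightarrow> 'a" where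
  "power_series c s = (\<Sum>n. s^n *\<^sub>R c n)"

definition deriv_coeffs :: "(nat \<Rightarrow> 'a::real_normed_vector) \<Rightarrow> nat \<Rightarrow> 'a" where
  "deriv_coeffs c n = real (Suc n) *\<^sub>R c (Suc n)"

lemma power_series_0: "power_series c 0 = c 0"
  unfolding power_series_def by (subst suminf_finite[of "{0}"]) (auto simp: power_0_left)

text \<open>Pairing with basis vectors reduces convergence and termwise differentiation to scalar
  power series.\<close>

lemma power_series_component:
  fixes c :: "nat \<Rightarrow> 'a::euclidean_space"
  assumes "entire_coeffs c"
  shows "summable (\<lambda>n. (c n \<bullet> b) * s^n)"
    and "power_series c s \<bullet> b = (\<Sum>n. (c n \<bullet> b) * s^n)"
proof -
  have *: "summable (\<lambda>n. s^n *\<^sub>R c n)" using assms by (simp add: entire_coeffs_def)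
  show "summable (\<lambda>n. (c n \<bullet> b) * s^n)"
    using bounded_linear.summable[OF bounded_linear_inner_left *, of b] by (simp add: mult.commute)
  show "power_series c s \<bullet> b = (\<Sum>n. (c n \<bullet> b) * s^n)"
    using bounded_linear.suminf[OF bounded_linear_inner_left *, of b]
    by (simp add: power_series_def mult.commute)
qed

lemma entire_coeffs_deriv:
  fixes c :: "nat \<Rightarrow> 'a::euclidean_space"
  assumes "entire_coeffs c"
  shows "entire_coeffs (deriv_coeffs c)"
proof -
  have "summable (\<lambda>n. s^n *\<^sub>R deriv_coeffs c n)" for s
  proof -
    have "summable (\<lambda>n. diffs (\<lambda>n. c n \<bullet> b) n * s^n)" for b
      using power_series_component(1)[OF assms] by (rule termdiff_converges_all)
    then have "summable (\<lambda>n. \<Sum>b\<in>Basis. (diffs (\<lambda>n. c n \<bullet> b) n * s^n) *\<^sub>R b)"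
      by (intro summable_sum summable_scaleR_left)
    also have "(\<lambda>n. \<Sum>b\<in>Basis. (diffs (\<lambda>n. c n \<bullet> b) n * s^n) *\<^sub>R b) = (\<lambda>n. s^n *\<^sub>R deriv_coeffs c n)"
    proof
      fix n
      have "(\<Sum>b\<in>Basis. (diffs (\<lambda>n. c n \<bullet> b) n * s^n) *\<^sub>R b) =
          (\<Sum>b\<in>Basis. ((s^n *\<^sub>R deriv_coeffs c n) \<bullet> b) *\<^sub>R b)"
        by (intro sum.cong) (simp_all add: diffs_def deriv_coeffs_def mult_ac)
      then show "(\<Sum>b\<in>Basis. (diffs (\<lambda>n. c n \<bullet> b) n * s^n) *\<^sub>R b) = s^n *\<^sub>R deriv_coeffs c n"
        by (simp only: euclidean_representation)
    qed
    finally show ?thesis .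
  qed
  then show ?thesis by (simp add: entire_coeffs_def)
qed

lemma has_vector_derivative_power_series:
  fixes c :: "nat \<Rightarrow> 'a::euclidean_space"
  assumes "entire_coeffs c"
  shows "(power_series c has_vector_derivative power_series (deriv_coeffs c) s) (at s)"
proof -
  have "((\<lambda>s. power_series c s \<bullet> b) has_derivative (\<lambda>h. (h *\<^sub>R power_series (deriv_coeffs c) s) \<bullet> b)) (at s)"
    for b
  proof -
    have "((\<lambda>s. \<Sum>n. (c n \<bullet> b) * s^n) has_field_derivative (\<Sum>n. diffs (\<lambda>n. c n \<bullet> b) n * s^n)) (at s)"
      using power_series_component(1)[OF assms] by (rule termdiffs_strong_converges_everywhere)
    also have "(\<Sum>n. diffs (\<lambda>n. c n \<bullet> b) n * s^n) = power_series (deriv_coeffs c) s \<bullet> b"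
      by (simp add: power_series_component(2)[OF entire_coeffs_deriv[OF assms]] diffs_def deriv_coeffs_def)
    finally show ?thesis
      by (simp add: has_field_derivative_def power_series_component(2)[OF assms] mult_commute_abs)
  qed
  then show ?thesis
    unfolding has_vector_derivative_def by (subst has_derivative_componentwise_within) auto
qed

lemma continuous_on_power_series:
  fixes c :: "nat \<Rightarrow> 'a::euclidean_space"
  assumes "entire_coeffs c"
  shows "continuous_on S (power_series c)"
  by (intro continuous_at_imp_continuous_on ballI
      has_vector_derivative_continuous[OF has_vector_derivative_power_series[OF assms]])

lemma power_series_bounded_linear:
  assumes "bounded_linear T" "entire_coeffs c"
  shows "entire_coeffs (\<lambda>n. T (c n))" "power_series (\<lambda>n. T (c n)) s = T (power_series c s)"
proof -
  interpret bounded_linear T by fact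
  have *: "summable (\<lambda>n. s^n *\<^sub>R c n)" for s :: real using assms(2) by (simp add: entire_coeffs_def)
  show "entire_coeffs (\<lambda>n. T (c n))"
    unfolding entire_coeffs_def using summable[OF *] by (simp add: scale)
  show "power_series (\<lambda>n. T (c n)) s = T (power_series c s)"
    unfolding power_series_def using suminf[OF *] by (simp add: scale)
qed

lemma power_series_add:
  assumes "entire_coeffs c" "entire_coeffs d"
  shows "entire_coeffs (\<lambda>n. c n + d n)"
    "power_series (\<lambda>n. c n + d n) s = power_series c s + power_series d s"
proof -
  show "entire_coeffs (\<lambda>n. c n + d n)" using assms
    unfolding entire_coeffs_def scaleR_add_right by (auto intro: summable_add)
  show "power_series (\<lambda>n. c n + d n) s = power_series c s + power_series d s"
    unfolding power_series_def scaleR_add_right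
    by (rule suminf_add[symmetric]) (use assms in \<open>auto simp: entire_coeffs_def\<close>)
qed

text \<open>Multiplying coefficients by their index is the Euler operator \<open>s * d/ds\<close>;
  this turns recurrences into differential equations.\<close>

lemma power_series_times_index:
  fixes c :: "nat \<Rightarrow> 'a::euclidean_space"
  assumes "entire_coeffs c"
  shows "entire_coeffs (\<lambda>n. real n *\<^sub>R c n)"
    "power_series (\<lambda>n. real n *\<^sub>R c n) s = s *\<^sub>R power_series (deriv_coeffs c) s"
proof -
  have d: "(\<lambda>n. s^n *\<^sub>R deriv_coeffs c n) sums power_series (deriv_coeffs c) s" for s
    using entire_coeffs_deriv[OF assms]
    unfolding power_series_def entire_coeffs_def by (auto intro: summable_sums)
  have "(\<lambda>n. s^(Suc n) *\<^sub>R (real (Suc n) *\<^sub>R c (Suc n))) sums (s *\<^sub>R power_series (deriv_coeffs c) s)" for s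
    using sums_scaleR_right[OF d, of s s] by (simp add: deriv_coeffs_def mult.assoc)
  then have *: "(\<lambda>n. s^n *\<^sub>R (real n *\<^sub>R c n)) sums (s *\<^sub>R power_series (deriv_coeffs c) s)" for s
    by (subst (asm) sums_Suc_iff) simp
  show "entire_coeffs (\<lambda>n. real n *\<^sub>R c n)"
    unfolding entire_coeffs_def using * by (auto intro: sums_summable)
  show "power_series (\<lambda>n. real n *\<^sub>R c n) s = s *\<^sub>R power_series (deriv_coeffs c) s"
    unfolding power_series_def[of "\<lambda>n. real n *\<^sub>R c n"] using * by (rule sums_unique[symmetric])
qed

lemma entire_coeffs_ratio:
  fixes c :: "nat \<Rightarrow> 'a::banach"
  assumes "\<And>n. n \<ge> N \<Longrightarrow> norm (c (Suc n)) * real (Suc n) \<le> K * norm (c n)"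
  shows "entire_coeffs c"
  unfolding entire_coeffs_def
proof
  fix s :: real
  \<comment> \<open>From \<open>L\<close> on, \<open>abs s * K\<close> is at most
    \<open>real (Suc n) / 2\<close>, so each term is at most half the previous one.\<close>
  define L where "L = max N (nat \<lceil>2 * \<bar>s\<bar> * K\<rceil>)"
  show "summable (\<lambda>n. s^n *\<^sub>R c n)"
  proof (rule summable_ratio_test[where c = "1/2" and N = L])
    fix n assume n: "L \<le> n"
    then have nN: "n \<ge> N" and "2 * \<bar>s\<bar> * K \<le> real n" by (auto simp: L_def)
    then have "\<bar>s\<bar> * K \<le> real (Suc n) / 2" by simp
    have "norm (c (Suc n)) * \<bar>s\<bar> * real (Suc n) \<le> \<bar>s\<bar> * K * norm (c n)"
      using mult_left_mono[OF assms[OF nN], of "\<bar>s\<bar>"] by (simp add: mult_ac)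
    also have "\<dots> \<le> real (Suc n) / 2 * norm (c n)"
      by (intro mult_right_mono norm_ge_zero) fact
    finally have "(norm (c (Suc n)) * \<bar>s\<bar>) * real (Suc n) \<le> (1/2 * norm (c n)) * real (Suc n)"
      by (simp add: mult_ac)
    then have "norm (c (Suc n)) * \<bar>s\<bar> \<le> 1/2 * norm (c n)"
      by (rule mult_right_le_imp_le) simp
    then have "\<bar>s\<bar>^n * (norm (c (Suc n)) * \<bar>s\<bar>) \<le> \<bar>s\<bar>^n * (1/2 * norm (c n))"
      by (intro mult_left_mono) auto
    then show "norm (s^Suc n *\<^sub>R c (Suc n)) \<le> 1/2 * norm (s^n *\<^sub>R c n)"
      by (simp add: power_abs abs_mult mult_ac)
  qed simp
qed

section \<open>Gronwall estimates for linear differential equations\<close>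

lemma exp_bound_of_deriv_le:
  fixes f :: "real \<Rightarrow> real"
  assumes deriv: "\<And>x. x \<ge> 0 \<Longrightarrow> (f has_real_derivative f' x) (at x)"
    and le: "\<And>x. x \<ge> 0 \<Longrightarrow> f' x \<le> k * f x" and t: "t \<ge> 0"
  shows "f t \<le> exp (k * t) * f 0"
proof -
  \<comment> \<open>The integrating factor makes the product nonincreasing. The sign of
    \<open>k\<close> is free: decay uses \<open>- (2 * c / K)\<close>, uniqueness
    \<open>2 * K\<close>.\<close>
  have "exp (- k * t) * f t \<le> exp (- k * 0) * f 0"
  proof (rule DERIV_nonpos_imp_nonincreasing[OF t])
    fix x :: real assume x: "0 \<le> x" 
    have "((\<lambda>x. exp (- k * x) * f x) has_real_derivative exp (- k * x) * (f' x - k * f x)) (at x)"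
      using deriv[OF x] by (auto intro!: derivative_eq_intros simp: algebra_simps)
    moreover have "exp (- k * x) * (f' x - k * f x) \<le> 0"
      using le[OF x] by (intro mult_nonneg_nonpos) auto
    ultimately show "\<exists>y. ((\<lambda>x. exp (- k * x) * f x) has_real_derivative y) (at x) \<and> y \<le> 0" by blast
  qed
  then have "exp (k * t) * (exp (- k * t) * f t) \<le> exp (k * t) * f 0" by simp
  then show ?thesis by (simp add: mult.assoc[symmetric] exp_add[symmetric])
qed

lemma has_real_derivative_bilinear_diagonal:
  assumes H: "bounded_bilinear H" "\<And>x y. H x y = (H y x :: real)"
    and f: "(f has_vector_derivative f') (at x)"
  shows "((\<lambda>x. H (f x) (f x)) has_real_derivative 2 * H (f x) f') (at x)"
  using bounded_bilinear.has_vector_derivative[OF H(1) f f] H(2)[of f' "f x"]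
  by (simp add: has_real_derivative_iff_has_vector_derivative)

text \<open>\<open>H (u t) (u t)\<close> is a Lyapunov function: its derivative is at most
  \<open>- (2 * c / K)\<close> times itself, \<open>K\<close> being a bound of \<open>H\<close>.
  Going back to the norm costs the factor \<open>sqrt K\<close>; \<open>d\<close> and
  \<open>C\<close> serve all solutions at once.\<close>

lemma lyapunov_accretive_decay:
  fixes T :: "'a::real_inner \<Rightarrow> 'a"
  assumes "lyapunov_accretive T"
  obtains d C where "d > 0" "C \<ge> 0"
    "\<And>u t. (\<And>x. x \<ge> 0 \<Longrightarrow> (u has_vector_derivative - T (u x)) (at x)) \<Longrightarrow> t \<ge> 0 \<Longrightarrow>
       norm (u t) \<le> C * exp (- d * t) * norm (u 0)"
proof -
  obtain H c where H: "bounded_bilinear H" "\<And>x y. H x y = H y x"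
     "\<And>x. (norm x)\<^sup>2 \<le> H x x" "0 < c" "\<And>x. c * (norm x)\<^sup>2 \<le> (H x (T x) :: real)"
    using assms unfolding lyapunov_accretive_def by blast
  obtain K where K: "K > 0" "\<And>x y. norm (H x y) \<le> norm x * norm y * K"
    using bounded_bilinear.pos_bounded[OF H(1)] by blast
  have HK: "H x x \<le> K * (norm x)\<^sup>2" for x
    using K(2)[of x x] by (simp add: power2_eq_square mult_ac)
  show ?thesis
  proof (rule that[of "c / K" "sqrt K"])
    fix u :: "real \<Rightarrow> 'a" and t :: real
    assume u: "\<And>x. x \<ge> 0 \<Longrightarrow> (u has_vector_derivative - T (u x)) (at x)" and t: "t \<ge> 0"
    have "H (u t) (u t) \<le> exp (- (2 * c / K) * t) * H (u 0) (u 0)"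
    proof (rule exp_bound_of_deriv_le[OF _ _ t])
      fix x :: real assume x: "x \<ge> 0"
      show "((\<lambda>x. H (u x) (u x)) has_real_derivative 2 * H (u x) (- T (u x))) (at x)"
        by (rule has_real_derivative_bilinear_diagonal[OF H(1,2) u[OF x]])
      have "c * (H (u x) (u x) / K) \<le> c * (norm (u x))\<^sup>2"
        using HK[of "u x"] K(1) H(4) by (intro mult_left_mono) (auto simp: field_simps)
      also have "\<dots> \<le> H (u x) (T (u x))" by (rule H)
      finally show "2 * H (u x) (- T (u x)) \<le> - (2 * c / K) * H (u x) (u x)"
        using bounded_bilinear.minus_right[OF H(1)] by simp
    qed
    also have "\<dots> \<le> exp (- (2 * c / K) * t) * (K * (norm (u 0))\<^sup>2)"
      by (intro mult_left_mono HK) auto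
    also have "\<dots> = (sqrt K * exp (- (c / K) * t) * norm (u 0))\<^sup>2"
      using K(1) by (simp add: power_mult_distrib exp_double[symmetric] mult_ac)
    finally have "(norm (u t))\<^sup>2 \<le> (sqrt K * exp (- (c / K) * t) * norm (u 0))\<^sup>2"
      using H(3)[of "u t"] by linarith
    then show "norm (u t) \<le> sqrt K * exp (- (c / K) * t) * norm (u 0)"
      by (rule power2_le_imp_le) (use K(1) in auto)
  qed (use H K in auto)
qed

text \<open>Gronwall for the squared norm of the difference, which starts at zero.\<close>

lemma linear_ode_unique:
  fixes T :: "'a::real_inner \<Rightarrow> 'a"
  assumes T: "bounded_linear T"
    and u: "\<And>x. x \<ge> 0 \<Longrightarrow> (u has_vector_derivative T (u x)) (at x)"
    and v: "\<And>x. x \<ge> 0 \<Longrightarrow> (v has_vector_derivative T (v x)) (at x)"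
    and "u 0 = v 0" and t: "t \<ge> 0"
  shows "u t = v t"
proof -
  obtain K where K: "\<And>x. norm (T x) \<le> norm x * K" using bounded_linear.bounded[OF T] by blast
  let ?w = "\<lambda>x. u x - v x"
  have "?w t \<bullet> ?w t \<le> exp (2 * K * t) * (?w 0 \<bullet> ?w 0)"
  proof (rule exp_bound_of_deriv_le[OF _ _ t])
    fix x :: real assume x: "x \<ge> 0"
    have "(?w has_vector_derivative T (?w x)) (at x)"
      using has_vector_derivative_diff[OF u[OF x] v[OF x]] by (simp add: linear_diff[OF bounded_linear.linear[OF T]])
    then show "((\<lambda>x. ?w x \<bullet> ?w x) has_real_derivative 2 * (?w x \<bullet> T (?w x))) (at x)"
      by (rule has_real_derivative_bilinear_diagonal[OF bounded_bilinear_inner inner_commute])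
    have "?w x \<bullet> T (?w x) \<le> norm (?w x) * norm (T (?w x))" by (rule norm_cauchy_schwarz)
    also have "\<dots> \<le> norm (?w x) * (norm (?w x) * K)" by (intro mult_left_mono K) auto
    finally show "2 * (?w x \<bullet> T (?w x)) \<le> 2 * K * (?w x \<bullet> ?w x)"
      by (simp add: power2_norm_eq_inner[symmetric] power2_eq_square mult_ac)
  qed
  then have "?w t \<bullet> ?w t \<le> 0" using assms(4) by simp
  then show ?thesis by (meson inner_gt_zero_iff not_le right_minus_eq)
qed

section \<open>The confluent hypergeometric equation\<close>

text \<open>\<open>rec\<close> is the coefficient form of
  \<open>s p'' + \<beta> p' = - (s \<eta> p' + \<eta> \<alpha> p)\<close>. Later \<alpha>, \<beta>
  and \<eta> are multiplications by \<open>A\<close>, \<open>B\<close> and \<open>Y\<close> on three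
  different indices of a tensor, \<beta> acting from the right.\<close>

context
  fixes \<alpha> \<beta> \<eta> :: "'a::euclidean_space \<Rightarrow> 'a" and c :: "nat \<Rightarrow> 'a"
  assumes \<alpha>: "bounded_linear \<alpha>" and \<beta>: "bounded_linear \<beta>" and \<eta>: "bounded_linear \<eta>"
    and commute: "\<And>x. \<alpha> (\<eta> x) = \<eta> (\<alpha> x)"
    and rec: "\<And>n. real (Suc n) *\<^sub>R (real n *\<^sub>R c (Suc n) + \<beta> (c (Suc n))) =
                - (real n *\<^sub>R \<eta> (c n) + \<alpha> (\<eta> (c n)))"
begin

text \<open>For large \<open>n\<close>, \<open>n + \<beta>\<close> is bounded below by
  \<open>n / 2\<close> and \<open>n + \<alpha>\<close> above by \<open>2 * n\<close>, so the
  recurrence bounds the ratio of consecutive norms by a multiple of \<open>1 / Suc n\<close>. Taking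
  \<open>N\<close> at least 1 allows cancelling \<open>n / 2\<close>.\<close>

lemma confluent_entire: "entire_coeffs c"
proof -
  obtain a where a: "a > 0" "\<And>x. norm (\<alpha> x) \<le> norm x * a"
    using bounded_linear.pos_bounded[OF \<alpha>] by blast
  obtain b where b: "b > 0" "\<And>x. norm (\<beta> x) \<le> norm x * b"
    using bounded_linear.pos_bounded[OF \<beta>] by blast
  obtain h where h: "h > 0" "\<And>x. norm (\<eta> x) \<le> norm x * h"
    using bounded_linear.pos_bounded[OF \<eta>] by blast
  define N where "N = max 1 (nat \<lceil>max (2 * b) a\<rceil>)"
  show ?thesis
  proof (rule entire_coeffs_ratio)
    fix n assume "N \<le> n"
    then have n: "n \<ge> 1" "real n \<ge> 2 * b" "real n \<ge> a" by (auto simp: N_def)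
    let ?u = "norm (c (Suc n))" and ?v = "norm (c n)"
    have "real n / 2 * ?u \<le> real n * ?u - ?u * b"
      using mult_right_mono[OF n(2), of ?u] by (simp add: algebra_simps)
    also have "\<dots> \<le> norm (real n *\<^sub>R c (Suc n)) - norm (\<beta> (c (Suc n)))"
      using b(2)[of "c (Suc n)"] by simp
    also have "\<dots> \<le> norm (real n *\<^sub>R c (Suc n) + \<beta> (c (Suc n)))"
      by (rule norm_diff_ineq)
    finally have "real (Suc n) * (real n / 2 * ?u) \<le>
        norm (real (Suc n) *\<^sub>R (real n *\<^sub>R c (Suc n) + \<beta> (c (Suc n))))"
      unfolding norm_scaleR by (intro mult_mono) auto
    also have "\<dots> = norm (real n *\<^sub>R \<eta> (c n) + \<alpha> (\<eta> (c n)))"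
      by (simp only: rec norm_minus_cancel)
    also have "\<dots> \<le> real n * norm (\<eta> (c n)) + norm (\<eta> (c n)) * a"
      using norm_triangle_ineq[of "real n *\<^sub>R \<eta> (c n)" "\<alpha> (\<eta> (c n))"] a(2)[of "\<eta> (c n)"] by simp
    also have "\<dots> = norm (\<eta> (c n)) * (real n + a)" by (simp add: algebra_simps)
    also have "\<dots> \<le> (?v * h) * (2 * real n)"
      using a h n by (intro mult_mono) auto
    finally have "(?u * real (Suc n)) * (real n / 2) \<le> (4 * h * ?v) * (real n / 2)"
      by (simp only: mult_ac) (simp add: mult_ac)
    then show "?u * real (Suc n) \<le> 4 * h * ?v"
      by (rule mult_right_le_imp_le) (use n in auto)
  qed
qed

text \<open>
  With \<open>p\<close> the series and \<open>r = s p' + \<alpha> p\<close>, the confluent hypergeometric equation is the system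
  \<open>s p' = r - \<alpha> p\<close>, \<open>r' = - \<eta> r + (1 + \<alpha> - \<beta>) p'\<close>. For large \<open>s\<close> the damping of \<open>p\<close> by
  \<open>\<alpha>/s\<close> and of \<open>r\<close> by \<open>\<eta>\<close> dominates the coupling, which has order \<open>1/s\<close>, so that the sum
  of the two Lyapunov forms decreases.
\<close>

lemma confluent_bounded:
  assumes "lyapunov_accretive \<alpha>" "lyapunov_accretive \<eta>"
  shows "\<exists>C. \<forall>s\<ge>0. norm (power_series c s) \<le> C"
proof -
  note c = confluent_entire
  note dc = entire_coeffs_deriv[OF c]
  note ddc = entire_coeffs_deriv[OF dc]
  define p where "p = power_series c"
  define p1 where "p1 = power_series (deriv_coeffs c)"
  define p2 where "p2 = power_series (deriv_coeffs (deriv_coeffs c))"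
  \<comment> \<open>This is \<open>rec\<close> summed against powers of \<open>s\<close>: the factor
    \<open>Suc n\<close> is absorbed into \<open>deriv_coeffs\<close>, and each factor
    \<open>n\<close> becomes \<open>s * d/ds\<close>.\<close>
  have ode: "s *\<^sub>R p2 s + \<beta> (p1 s) = - (s *\<^sub>R \<eta> (p1 s) + \<eta> (\<alpha> (p s)))" for s
  proof -
    interpret \<eta>: bounded_linear \<eta> by (rule \<eta>)
    interpret \<beta>: bounded_linear \<beta> by (rule \<beta>)
    have e\<eta>: "entire_coeffs (\<lambda>n. \<eta> (c n))" by (rule power_series_bounded_linear[OF \<eta> c])
    have "s *\<^sub>R p2 s + \<beta> (p1 s) =
       power_series (\<lambda>n. real n *\<^sub>R deriv_coeffs c n + \<beta> (deriv_coeffs c n)) s"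
      unfolding p1_def p2_def
      by (simp add: power_series_add power_series_times_index[OF dc] power_series_bounded_linear[OF \<beta> dc])
    also have "(\<lambda>n. real n *\<^sub>R deriv_coeffs c n + \<beta> (deriv_coeffs c n)) =
       (\<lambda>n. - (\<eta> (real n *\<^sub>R c n) + \<eta> (\<alpha> (c n))))"
      unfolding deriv_coeffs_def using rec
      by (simp add: \<beta>.scaleR \<eta>.scaleR commute scaleR_add_right mult.commute del: of_nat_Suc)
    also have "power_series \<dots> s = - (\<eta> (s *\<^sub>R p1 s) + \<eta> (\<alpha> (p s)))"
    proof -
      note t = power_series_bounded_linear[OF \<eta> power_series_times_index(1)[OF c]]
      note a = power_series_bounded_linear[OF bounded_linear_compose[OF \<eta> \<alpha>] c]
      show ?thesis
        using power_series_bounded_linear(2)[OF bounded_linear_minus[OF bounded_linear_ident]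
            power_series_add(1)[OF t(1) a(1)], of s]
        by (simp add: power_series_add(2)[OF t(1) a(1)] t(2) a(2) power_series_times_index(2)[OF c] p_def p1_def)
    qed
    finally show ?thesis by (simp add: \<eta>.scaleR)
  qed
  obtain Ha ca where Ha: "bounded_bilinear Ha" "\<And>x y. Ha x y = Ha y x"
     "\<And>x. (norm x)\<^sup>2 \<le> Ha x x" "0 < ca" "\<And>x. ca * (norm x)\<^sup>2 \<le> (Ha x (\<alpha> x) :: real)"
    using assms(1) unfolding lyapunov_accretive_def by blast
  obtain He ce where He: "bounded_bilinear He" "\<And>x y. He x y = He y x"
     "\<And>x. (norm x)\<^sup>2 \<le> He x x" "0 < ce" "\<And>x. ce * (norm x)\<^sup>2 \<le> (He x (\<eta> x) :: real)"
    using assms(2) unfolding lyapunov_accretive_def by blast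
  define g where "g x = x + \<alpha> x - \<beta> x" for x
  have g: "bounded_linear g" unfolding g_def[abs_def]
    by (intro bounded_linear_sub bounded_linear_add bounded_linear_ident \<alpha> \<beta>)
  note Heg = bounded_bilinear.comp[OF He(1) bounded_linear_ident g]
  note Hega = bounded_bilinear.comp[OF He(1) bounded_linear_ident bounded_linear_compose[OF g \<alpha>]]
  obtain K1 where K1: "K1 > 0" "\<And>x y. norm (Ha x y) \<le> norm x * norm y * K1"
    using bounded_bilinear.pos_bounded[OF Ha(1)] by blast
  obtain K2 where K2: "K2 > 0" "\<And>x y. norm (He x (g y)) \<le> norm x * norm y * K2"
    using bounded_bilinear.pos_bounded[OF Heg] by blast
  obtain K3 where K3: "K3 > 0" "\<And>x y. norm (He x (g (\<alpha> y))) \<le> norm x * norm y * K3"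
    using bounded_bilinear.pos_bounded[OF Hega] by blast
  define K where "K = K1 + K3"
  \<comment> \<open>From \<open>s0\<close> on, \<open>s * ce\<close> absorbs both the self-coupling
    bound \<open>K2\<close> of \<open>r\<close> and the \<open>K^2 / (4 * ca)\<close> left by
    completing the square in the cross terms, whose constants add up to \<open>K\<close>. The
    \<open>1\<close> keeps \<open>s\<close> positive.\<close>
  define s0 where "s0 = max 1 ((K2 + K\<^sup>2 / (4 * ca)) / ce)"
  have s0: "s0 \<ge> 1" by (simp add: s0_def)
  define r where "r s = s *\<^sub>R p1 s + \<alpha> (p s)" for s
  define E where "E s = Ha (p s) (p s) + He (r s) (r s)" for s
  have dp: "(p has_vector_derivative p1 s) (at s)" for s
    unfolding p_def p1_def by (rule has_vector_derivative_power_series[OF c])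
  have dp1: "(p1 has_vector_derivative p2 s) (at s)" for s
    unfolding p2_def p1_def by (rule has_vector_derivative_power_series[OF dc])
  have dr: "(r has_vector_derivative g (p1 s) - \<eta> (r s)) (at s)" for s
  proof -
    have "((\<lambda>s. s *\<^sub>R p1 s + \<alpha> (p s)) has_vector_derivative
        (s *\<^sub>R p2 s + 1 *\<^sub>R p1 s) + \<alpha> (p1 s)) (at s)"
      by (intro has_vector_derivative_add has_vector_derivative_scaleR DERIV_ident dp1
          bounded_linear.has_vector_derivative[OF \<alpha>] dp)
    moreover have "(s *\<^sub>R p2 s + 1 *\<^sub>R p1 s) + \<alpha> (p1 s) = g (p1 s) - \<eta> (r s)"
    proof -
      have "s *\<^sub>R p2 s = - (s *\<^sub>R \<eta> (p1 s) + \<eta> (\<alpha> (p s))) - \<beta> (p1 s)"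
        by (simp only: ode[symmetric]) simp
      then show ?thesis by (simp only:) (simp add: g_def r_def linear_add[OF bounded_linear.linear[OF \<eta>]]
          linear_scale[OF bounded_linear.linear[OF \<eta>]] algebra_simps)
    qed
    ultimately show ?thesis by (simp add: r_def[abs_def])
  qed
  have E_decr: "E s \<le> E s0" if "s \<ge> s0" for s
  proof (rule DERIV_nonpos_imp_nonincreasing[OF that])
    fix x assume x: "s0 \<le> x"
    with s0 have x0: "x > 0" by simp
    let ?P = "norm (p x)" and ?R = "norm (r x)"
    have "(E has_real_derivative 2 * Ha (p x) (p1 x) + 2 * He (r x) (g (p1 x) - \<eta> (r x))) (at x)"
      unfolding E_def[abs_def]
      by (intro DERIV_add has_real_derivative_bilinear_diagonal Ha(1,2) He(1,2) dp dr)
    moreover have "2 * Ha (p x) (p1 x) + 2 * He (r x) (g (p1 x) - \<eta> (r x)) \<le> 0"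
    proof -
      \<comment> \<open>The estimates below are multiplied by \<open>x > 0\<close>, so that
        \<open>x p'\<close> can be replaced by \<open>r - \<alpha> p\<close>.\<close>
      have xp1: "x *\<^sub>R p1 x = r x - \<alpha> (p x)" by (simp add: r_def)
      have "x * Ha (p x) (p1 x) = Ha (p x) (r x) - Ha (p x) (\<alpha> (p x))"
        by (simp add: bounded_bilinear.scaleR_right[OF Ha(1), symmetric, unfolded real_scaleR_def]
            xp1 bounded_bilinear.diff_right[OF Ha(1)])
      also have "\<dots> \<le> ?P * ?R * K1 - ca * ?P\<^sup>2"
        using K1(2)[of "p x" "r x"] Ha(5)[of "p x"] by simp
      finally have 1: "x * Ha (p x) (p1 x) \<le> ?P * ?R * K1 - ca * ?P\<^sup>2" .
      have "x * He (r x) (g (p1 x)) = He (r x) (g (r x)) - He (r x) (g (\<alpha> (p x)))"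
        by (simp add: bounded_bilinear.scaleR_right[OF Heg, symmetric, unfolded real_scaleR_def]
            xp1 bounded_bilinear.diff_right[OF Heg])
      also have "\<dots> \<le> ?R * ?R * K2 + ?R * ?P * K3"
        using K2(2)[of "r x" "r x"] K3(2)[of "r x" "p x"] by simp
      finally have 2: "x * He (r x) (g (p1 x)) \<le> ?R\<^sup>2 * K2 + ?P * ?R * K3"
        by (simp add: power2_eq_square mult_ac)
      have "K2 + K\<^sup>2 / (4 * ca) \<le> x * ce"
        using x He(4) by (simp add: s0_def divide_le_eq)
      then have "(K2 + K\<^sup>2 / (4 * ca)) * ?R\<^sup>2 \<le> x * ce * ?R\<^sup>2" by (intro mult_right_mono) auto
      also have "\<dots> \<le> x * He (r x) (\<eta> (r x))"
        using He(5)[of "r x"] x0 by simp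
      finally have 3: "K2 * ?R\<^sup>2 + K\<^sup>2 / (4 * ca) * ?R\<^sup>2 \<le> x * He (r x) (\<eta> (r x))"
        by (simp add: distrib_right)
      have "0 \<le> (2 * ca * ?P - K * ?R)\<^sup>2 / (4 * ca)" using Ha(4) by simp
      also have "\<dots> = ca * ?P\<^sup>2 - K * (?P * ?R) + K\<^sup>2 / (4 * ca) * ?R\<^sup>2"
        using Ha(4) by (simp add: field_simps power2_eq_square)
      finally have 4: "K * (?P * ?R) \<le> ca * ?P\<^sup>2 + K\<^sup>2 / (4 * ca) * ?R\<^sup>2" by simp
      have "x * (Ha (p x) (p1 x) + He (r x) (g (p1 x)) - He (r x) (\<eta> (r x))) \<le> 0"
        using 1 2 3 4 by (simp add: K_def algebra_simps)
      then have "Ha (p x) (p1 x) + He (r x) (g (p1 x)) - He (r x) (\<eta> (r x)) \<le> 0"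
        using x0 by (simp add: mult_le_0_iff)
      then show ?thesis by (simp add: bounded_bilinear.diff_right[OF He(1)])
    qed
    ultimately show "\<exists>y. (E has_real_derivative y) (at x) \<and> y \<le> 0" by blast
  qed
  \<comment> \<open>Up to \<open>s0\<close> compactness bounds \<open>p\<close>; afterwards
    \<open>E\<close> does, since it dominates the square of \<open>norm (p s)\<close>.\<close>
  have "compact (p ` {0..s0})"
    unfolding p_def by (intro compact_continuous_image continuous_on_power_series c) auto
  then obtain C where C: "\<And>s. s \<in> {0..s0} \<Longrightarrow> norm (p s) \<le> C"
    using compact_imp_bounded bounded_iff by (metis imageI)
  have "norm (p s) \<le> max C (sqrt (E s0))" if "s \<ge> 0" for s
  proof (cases "s \<le> s0")
    case True
    then show ?thesis using C[of s] that by auto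
  next
    case False
    have "0 \<le> He (r s) (r s)" using He(3)[of "r s"] zero_le_power2 order_trans by blast
    then have "(norm (p s))\<^sup>2 \<le> E s" using Ha(3)[of "p s"] by (simp add: E_def)
    also have "\<dots> \<le> E s0" using E_decr False by simp
    finally show ?thesis using real_le_rsqrt by fastforce
  qed
  then show ?thesis unfolding p_def by blast
qed

end

section \<open>The matrix confluent hypergeometric function\<close>

lemma matrix_pow_scaleR: "matrix_pow (s *\<^sub>R M) n = s^n *\<^sub>R matrix_pow M n"
  by (induction n)
    (simp_all add: linear_scale[OF linear_matrix_mult_left] linear_scale[OF linear_matrix_mult_right] mult.commute)

lemma matrix_pochhammer_commute: "M ** matrix_pochhammer M n = matrix_pochhammer M n ** M"
proof (induction n)
  case (Suc n)
  have "M ** (M + mat c) = (M + mat c) ** M" for c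
    by (simp add: linear_add[OF linear_matrix_mult_left] linear_add[OF linear_matrix_mult_right] mat_mult_commute)
  then show ?case using Suc by (metis matrix_pochhammer.simps(2) matrix_mul_assoc)
qed simp

lemma matrix_pochhammer_Suc': "matrix_pochhammer M (Suc n) = (M + mat (of_nat n)) ** matrix_pochhammer M n"
  by (simp add: linear_add[OF linear_matrix_mult_left] linear_add[OF linear_matrix_mult_right]
      mat_mult_commute matrix_pochhammer_commute)

text \<open>A kernel vector of \<open>B + mat (of_nat n)\<close> would be an eigenvector of
  \<open>B\<close> for \<open>- n\<close>, so every factor is invertible.\<close>

lemma invertible_matrix_pochhammer:
  assumes "positive_stable B"
  shows "invertible (matrix_pochhammer B n)"
proof (induction n)
  case 0
  show ?case by (auto simp: invertible_def intro: exI[of _ "mat 1"])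
next
  case (Suc n)
  have "invertible (B + mat (of_nat n))"
  proof (rule ccontr)
    assume "\<not> invertible (B + mat (of_nat n))"
    then obtain v where v: "v \<noteq> 0" "(B + mat (of_nat n)) *v v = 0"
      by (auto simp: invertible_left_inverse matrix_left_invertible_ker)
    then have "B *v v = - of_nat n *s v"
      by (simp add: matrix_vector_mult_add_rdistrib mat_mult_vec vec_eq_iff add_eq_0_iff2)
    then have "0 < Re (- of_nat n)"
      using assms v(1) unfolding positive_stable_def matrix_eigenvalue_def by blast
    then show False by simp
  qed
  then show ?case using Suc by (simp add: invertible_mult)
qed

lemma matrix_inv_pochhammer_Suc:
  assumes "positive_stable B"
  shows "matrix_inv (matrix_pochhammer B (Suc n)) ** (B + mat (of_nat n)) = matrix_inv (matrix_pochhammer B n)"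
proof -
  let ?P = "matrix_pochhammer B"
  have inv: "matrix_inv (?P k) ** ?P k = mat 1" "?P k ** matrix_inv (?P k) = mat 1" for k
    using someI_ex[OF invertible_matrix_pochhammer[OF assms, of k, unfolded invertible_def]]
    by (simp_all add: matrix_inv_def)
  have "matrix_inv (?P (Suc n)) ** (B + mat (of_nat n)) =
      matrix_inv (?P (Suc n)) ** ((B + mat (of_nat n)) ** ?P n) ** matrix_inv (?P n)"
    by (simp only: matrix_mul_assoc[symmetric] inv(2) matrix_mul_rid)
  also have "\<dots> = matrix_inv (?P n)"
    by (simp only: matrix_pochhammer_Suc'[symmetric] inv(1) matrix_mul_lid)
  finally show ?thesis .
qed

definition hyp_coeff :: "complex^'r^'r \<Rightarrow> complex^'r^'r \<Rightarrow> nat \<Rightarrow> complex^'r^'r" where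
  "hyp_coeff A B n = matrix_pochhammer A n ** matrix_inv (matrix_pochhammer B n)"

text \<open>The new factor of the symbol of \<open>B\<close> cancels from the right, and that of
  \<open>A\<close> comes out on the left. Hence \<open>A\<close> acts by left and \<open>B\<close>
  by right multiplication.\<close>

lemma hyp_coeff_Suc:
  assumes "positive_stable B"
  shows "of_nat n *\<^sub>R hyp_coeff A B (Suc n) + hyp_coeff A B (Suc n) ** B =
         of_nat n *\<^sub>R hyp_coeff A B n + A ** hyp_coeff A B n"
proof -
  have s: "real n *\<^sub>R X = mat (of_nat n) ** X" for X :: "complex^'a^'a"
    using scaleR_eq_mat_mult[of "real n" X] by simp
  have "of_nat n *\<^sub>R hyp_coeff A B (Suc n) + hyp_coeff A B (Suc n) ** B =
      hyp_coeff A B (Suc n) ** (B + mat (of_nat n))"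
    by (simp add: linear_add[OF linear_matrix_mult_left] s mat_mult_commute)
  also have "\<dots> = (A + mat (of_nat n)) ** hyp_coeff A B n"
    unfolding hyp_coeff_def
    by (simp only: matrix_mul_assoc[symmetric] matrix_inv_pochhammer_Suc[OF assms])
      (simp only: matrix_mul_assoc matrix_pochhammer_Suc')
  also have "\<dots> = of_nat n *\<^sub>R hyp_coeff A B n + A ** hyp_coeff A B n"
    by (simp add: linear_add[OF linear_matrix_mult_right] s)
  finally show ?thesis .
qed

section \<open>Tensors with a separate index for each matrix action\<close>

lemma norm_vec_sq: "(norm (x :: 'a::real_inner^'n))\<^sup>2 = (\<Sum>i\<in>UNIV. (norm (x $ i))\<^sup>2)"
  by (simp add: power2_norm_eq_inner inner_vec_def)

lemma sum_UNIV_triple: "(\<Sum>(i,j,k)\<in>UNIV. f i j k) = (\<Sum>i\<in>UNIV. \<Sum>j\<in>UNIV. \<Sum>k\<in>UNIV. f i j k)"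
  by (simp add: sum.cartesian_product split_def flip: UNIV_Times_UNIV)

text \<open>A Kronecker product with its four indices kept apart: \<open>m\<close>, \<open>k\<close>
  belong to \<open>P\<close> and \<open>i\<close>, \<open>j\<close> to \<open>Q\<close>. Then
  \<open>Y\<close> acts on \<open>m\<close>, \<open>A\<close> on \<open>i\<close> and
  \<open>B\<close> on \<open>j\<close>, so noncommuting matrices act by commuting operators.\<close>

definition tensor :: "complex^'r^'r \<Rightarrow> complex^'r^'r \<Rightarrow> complex^'r^'r^'r^'r" where
  "tensor P Q = (\<chi> m k i j. P $ m $ k * Q $ i $ j)"

lemma bounded_bilinear_tensor: "bounded_bilinear tensor"
  unfolding bilinear_conv_bounded_bilinear[symmetric] bilinear_def
  by (auto intro!: linearI simp: tensor_def vec_eq_iff algebra_simps)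

definition tensor_row :: "complex^'r^'r \<Rightarrow> complex^'r^'r^'r^'r \<Rightarrow> complex^'r^'r^'r^'r" where
  "tensor_row A x = (\<chi> m k. A ** x $ m $ k)"

definition tensor_col :: "complex^'r^'r \<Rightarrow> complex^'r^'r^'r^'r \<Rightarrow> complex^'r^'r^'r^'r" where
  "tensor_col B x = (\<chi> m k. x $ m $ k ** B)"

definition tensor_first :: "complex^'r^'r \<Rightarrow> complex^'r^'r^'r^'r \<Rightarrow> complex^'r^'r^'r^'r" where
  "tensor_first Y x = (\<chi> m k i j. \<Sum>l\<in>UNIV. Y $ m $ l * x $ l $ k $ i $ j)"

text \<open>Contracting \<open>m\<close> with \<open>j\<close> returns to matrices, in the order
  coefficient times power used by \<open>matrix_1F1\<close>.\<close>

definition tensor_contract :: "complex^'r^'r^'r^'r \<Rightarrow> complex^'r^'r" where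
  "tensor_contract x = (\<chi> i k. \<Sum>j\<in>UNIV. x $ j $ k $ i $ j)"

lemma tensor_row_tensor: "tensor_row A (tensor P Q) = tensor P (A ** Q)"
  by (simp add: tensor_row_def tensor_def vec_eq_iff matrix_matrix_mult_def sum_distrib_left mult_ac)

lemma tensor_col_tensor: "tensor_col B (tensor P Q) = tensor P (Q ** B)"
  by (simp add: tensor_col_def tensor_def vec_eq_iff matrix_matrix_mult_def sum_distrib_left mult_ac)

lemma tensor_first_tensor: "tensor_first Y (tensor P Q) = tensor (Y ** P) Q"
  by (simp add: tensor_first_def tensor_def vec_eq_iff matrix_matrix_mult_def sum_distrib_left mult_ac)

lemma tensor_contract_tensor: "tensor_contract (tensor P Q) = Q ** P"
  by (simp add: tensor_contract_def tensor_def vec_eq_iff matrix_matrix_mult_def mult_ac)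

lemma bounded_linear_tensor_row: "bounded_linear (tensor_row A)"
  unfolding linear_conv_bounded_linear[symmetric]
  by (rule linearI) (simp_all add: tensor_row_def vec_eq_iff
      linear_add[OF linear_matrix_mult_left] linear_scale[OF linear_matrix_mult_left])

lemma bounded_linear_tensor_col: "bounded_linear (tensor_col A)"
  unfolding linear_conv_bounded_linear[symmetric]
  by (rule linearI) (simp_all add: tensor_col_def vec_eq_iff
      linear_add[OF linear_matrix_mult_right] linear_scale[OF linear_matrix_mult_right])

lemma bounded_linear_tensor_first: "bounded_linear (tensor_first A)"
  unfolding linear_conv_bounded_linear[symmetric]
  by (rule linearI) (simp_all add: tensor_first_def vec_eq_iff distrib_left sum.distrib scaleR_sum_right)

lemma bounded_linear_tensor_contract: "bounded_linear tensor_contract"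
  unfolding linear_conv_bounded_linear[symmetric]
  by (rule linearI) (simp_all add: tensor_contract_def vec_eq_iff sum.distrib scaleR_sum_right)

lemma tensor_row_first: "tensor_row A (tensor_first Y x) = tensor_first Y (tensor_row A x)"
proof -
  have "(\<Sum>q\<in>UNIV. A $ i $ q * (\<Sum>l\<in>UNIV. Y $ m $ l * x $ l $ k $ q $ j)) =
        (\<Sum>l\<in>UNIV. Y $ m $ l * (\<Sum>q\<in>UNIV. A $ i $ q * x $ l $ k $ q $ j))" for i m k j
    unfolding sum_distrib_left by (subst sum.swap) (simp add: mult_ac)
  then show ?thesis
    by (simp add: tensor_row_def tensor_first_def vec_eq_iff matrix_matrix_mult_def)
qed

text \<open>Fixing \<open>m\<close>, \<open>k\<close>, \<open>j\<close> leaves a vector in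
  \<open>i\<close> on which the operator is multiplication by \<open>A\<close>, and the squared
  norms of these slices add up.\<close>

lemma lyapunov_accretive_tensor_row:
  assumes "positive_stable A"
  shows "lyapunov_accretive (tensor_row A)"
proof (rule lyapunov_accretive_lift[OF lyapunov_accretive_positive_stable[OF assms],
      where I = UNIV and \<pi> = "\<lambda>u x. \<chi> i. x $ fst u $ fst (snd u) $ i $ snd (snd u)"])
  show "bounded_linear (\<lambda>x::complex^'a^'a^'a^'a. \<chi> i. x $ fst u $ fst (snd u) $ i $ snd (snd u))"
    for u :: "'a \<times> 'a \<times> 'a"
    by (rule linearI[THEN linear_conv_bounded_linear[THEN iffD1]])
      (simp_all add: vec_eq_iff)
  show "(norm x)\<^sup>2 = (\<Sum>u\<in>UNIV. (norm (\<chi> i. x $ fst u $ fst (snd u) $ i $ snd (snd u)))\<^sup>2)"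
    for x :: "complex^'a^'a^'a^'a"
  proof -
    have "(norm x)\<^sup>2 = (\<Sum>m\<in>UNIV. \<Sum>k\<in>UNIV. \<Sum>i\<in>UNIV. \<Sum>j\<in>UNIV. (norm (x $ m $ k $ i $ j))\<^sup>2)"
      by (simp add: norm_vec_sq)
    also have "\<dots> = (\<Sum>m\<in>UNIV. \<Sum>k\<in>UNIV. \<Sum>j\<in>UNIV. (norm (\<chi> i. x $ m $ k $ i $ j))\<^sup>2)"
    proof (rule sum.cong[OF refl], rule sum.cong[OF refl])
      show "(\<Sum>i\<in>UNIV. \<Sum>j\<in>UNIV. (norm (x $ m $ k $ i $ j))\<^sup>2) =
          (\<Sum>j\<in>UNIV. (norm (\<chi> i. x $ m $ k $ i $ j))\<^sup>2)" for m k
        by (subst sum.swap) (simp add: norm_vec_sq)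
    qed
    finally show ?thesis
      by (simp add: split_def flip: sum_UNIV_triple)
  qed
qed (auto simp: tensor_row_def vec_eq_iff matrix_vector_mult_def matrix_matrix_mult_def)

text \<open>Here the slices are the vectors in \<open>m\<close>, with the other three indices
  fixed.\<close>

lemma lyapunov_accretive_tensor_first:
  assumes "positive_stable A"
  shows "lyapunov_accretive (tensor_first A)"
proof (rule lyapunov_accretive_lift[OF lyapunov_accretive_positive_stable[OF assms],
      where I = UNIV and \<pi> = "\<lambda>u x. \<chi> m. x $ m $ fst u $ fst (snd u) $ snd (snd u)"])
  show "bounded_linear (\<lambda>x::complex^'a^'a^'a^'a. \<chi> m. x $ m $ fst u $ fst (snd u) $ snd (snd u))"
    for u :: "'a \<times> 'a \<times> 'a"
    by (rule linearI[THEN linear_conv_bounded_linear[THEN iffD1]])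
      (simp_all add: vec_eq_iff)
  show "(norm x)\<^sup>2 = (\<Sum>u\<in>UNIV. (norm (\<chi> m. x $ m $ fst u $ fst (snd u) $ snd (snd u)))\<^sup>2)"
    for x :: "complex^'a^'a^'a^'a"
  proof -
    have "(norm x)\<^sup>2 = (\<Sum>m\<in>UNIV. \<Sum>(k,i,j)\<in>UNIV. (norm (x $ m $ k $ i $ j))\<^sup>2)"
      by (simp add: norm_vec_sq sum_UNIV_triple)
    also have "\<dots> = (\<Sum>u\<in>UNIV. \<Sum>m\<in>UNIV. (case u of (k,i,j) \<Rightarrow> (norm (x $ m $ k $ i $ j))\<^sup>2))"
      by (rule sum.swap)
    finally show ?thesis
      by (simp add: split_def norm_vec_sq)
  qed
qed (auto simp: tensor_first_def vec_eq_iff matrix_vector_mult_def)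

text \<open>The sign of the argument is carried by \<open>- Y\<close>, so the beta integral
  evaluates the series at \<open>s = 1 / (t * (1 - t)) \<ge> 0\<close>.\<close>

definition hyp_tensor :: "complex^'r^'r \<Rightarrow> complex^'r^'r \<Rightarrow> complex^'r^'r \<Rightarrow> nat \<Rightarrow> complex^'r^'r^'r^'r" where
  "hyp_tensor A B Y n = (1 / fact n) *\<^sub>R tensor (matrix_pow (- Y) n) (hyp_coeff A B n)"

text \<open>This supplies \<open>rec\<close> for \<open>tensor_row A\<close>,
  \<open>tensor_col B\<close> and \<open>tensor_first Y\<close>: the second tensor slot follows
  \<open>hyp_coeff_Suc\<close>, the first gains a factor \<open>- Y\<close>.\<close>

lemma hyp_tensor_rec:
  assumes "positive_stable B"
  shows "real (Suc n) *\<^sub>R (real n *\<^sub>R hyp_tensor A B Y (Suc n) + tensor_col B (hyp_tensor A B Y (Suc n))) =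
    - (real n *\<^sub>R tensor_first Y (hyp_tensor A B Y n) + tensor_row A (tensor_first Y (hyp_tensor A B Y n)))"
proof -
  interpret t: bounded_bilinear tensor by (rule bounded_bilinear_tensor)
  interpret col: bounded_linear "tensor_col B" by (rule bounded_linear_tensor_col)
  interpret row: bounded_linear "tensor_row A" by (rule bounded_linear_tensor_row)
  interpret first: bounded_linear "tensor_first Y" by (rule bounded_linear_tensor_first)
  let ?W = "matrix_pow (- Y)" and ?C = "hyp_coeff A B"
  have f: "real (Suc n) * (1 / fact (Suc n)) = 1 / fact n"
    by (simp add: divide_simps del: of_nat_Suc)
  have "real (Suc n) *\<^sub>R (real n *\<^sub>R hyp_tensor A B Y (Suc n) + tensor_col B (hyp_tensor A B Y (Suc n))) =
    (real (Suc n) * (1 / fact (Suc n))) *\<^sub>R tensor (?W (Suc n)) (real n *\<^sub>R ?C (Suc n) + ?C (Suc n) ** B)"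
    by (simp add: hyp_tensor_def col.scaleR tensor_col_tensor t.add_right t.scaleR_right
        scaleR_add_right mult_ac del: matrix_pow.simps fact_Suc of_nat_Suc)
  also have "\<dots> = (1 / fact n) *\<^sub>R tensor (- (Y ** ?W n)) (real n *\<^sub>R ?C n + A ** ?C n)"
    unfolding f hyp_coeff_Suc[OF assms]
    by (simp add: linear_neg[OF linear_matrix_mult_right])
  also have "\<dots> = - (real n *\<^sub>R tensor_first Y (hyp_tensor A B Y n) +
      tensor_row A (tensor_first Y (hyp_tensor A B Y n)))"
    by (simp add: hyp_tensor_def first.scaleR row.scaleR tensor_first_tensor tensor_row_tensor
        t.minus_left t.add_right t.scaleR_right algebra_simps)
  finally show ?thesis .
qed

section \<open>Continuity and boundedness of the hypergeometric function on a ray\<close>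

context
  fixes A B Y :: "complex^'r^'r"
  assumes stable: "positive_stable A" "positive_stable B" "positive_stable Y"
begin

lemma hyp_tensor_entire: "entire_coeffs (hyp_tensor A B Y)"
  by (rule confluent_entire[OF bounded_linear_tensor_row bounded_linear_tensor_col
        bounded_linear_tensor_first tensor_row_first hyp_tensor_rec[OF stable(2)]])

lemma matrix_1F1_eq_power_series:
  "matrix_1F1 A B (- (s *\<^sub>R Y)) = tensor_contract (power_series (hyp_tensor A B Y) s)"
proof -
  have "matrix_1F1 A B (s *\<^sub>R (- Y)) = power_series (\<lambda>n. tensor_contract (hyp_tensor A B Y n)) s"
    unfolding matrix_1F1_def power_series_def matrix_pow_scaleR
    by (simp add: hyp_tensor_def hyp_coeff_def tensor_contract_tensor mult.commute
        linear_scale[OF linear_matrix_mult_left]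
        linear_scale[OF bounded_linear.linear[OF bounded_linear_tensor_contract]])
  then show ?thesis
    by (simp add: power_series_bounded_linear(2)[OF bounded_linear_tensor_contract hyp_tensor_entire])
qed

lemma continuous_on_matrix_1F1: "continuous_on S (\<lambda>s. matrix_1F1 A B (- (s *\<^sub>R Y)))"
  unfolding matrix_1F1_eq_power_series
  by (intro bounded_linear.continuous_on[OF bounded_linear_tensor_contract]
      continuous_on_power_series hyp_tensor_entire)

text \<open>Uniformity in \<open>s\<close> matters because \<open>1 / (t * (1 - t))\<close> tends to
  infinity at both endpoints. The confluent bound, with \<open>A\<close> and \<open>Y\<close>
  supplying the accretive operators, is contracted back to matrices.\<close>

lemma matrix_1F1_bounded: "\<exists>C. \<forall>s\<ge>0. norm (matrix_1F1 A B (- (s *\<^sub>R Y))) \<le> C"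
proof -
  obtain C where C: "\<And>s. s \<ge> 0 \<Longrightarrow> norm (power_series (hyp_tensor A B Y) s) \<le> C"
    using confluent_bounded[OF bounded_linear_tensor_row bounded_linear_tensor_col
        bounded_linear_tensor_first tensor_row_first hyp_tensor_rec[OF stable(2)]
        lyapunov_accretive_tensor_row[OF stable(1)] lyapunov_accretive_tensor_first[OF stable(3)]]
    by blast
  obtain K where K: "K > 0" "\<And>x. norm (tensor_contract x :: complex^'r^'r) \<le> norm x * K"
    using bounded_linear.pos_bounded[OF bounded_linear_tensor_contract] by blast
  have "norm (matrix_1F1 A B (- (s *\<^sub>R Y))) \<le> C * K" if "s \<ge> 0" for s
    unfolding matrix_1F1_eq_power_series
    using K(2) mult_right_mono[OF C[OF that], of K] K(1) by (meson less_imp_le order_trans)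
  then show ?thesis by blast
qed

end

section \<open>Real powers of matrices and the beta integral\<close>

lemma bounded_linear_matrix_mult_left: "bounded_linear ((**) M :: complex^'k^'n \<Rightarrow> complex^'k^'m)"
  by (simp add: linear_matrix_mult_left flip: linear_conv_bounded_linear)

section \<open>The matrix exponential along a ray and its differential equation\<close>

definition exp_coeff :: "complex^'r^'r \<Rightarrow> nat \<Rightarrow> complex^'r^'r" where
  "exp_coeff M n = (1 / fact n) *\<^sub>R matrix_pow M n"

lemma exp_coeff_Suc: "real (Suc n) *\<^sub>R exp_coeff M (Suc n) = M ** exp_coeff M n"
proof -
  have "real (Suc n) * (1 / fact (Suc n)) = 1 / fact n"
    by (simp add: divide_simps del: of_nat_Suc)
  then show ?thesis unfolding exp_coeff_def
    by (simp add: linear_scale[OF linear_matrix_mult_left] del: fact_Suc of_nat_Suc)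
qed

lemma exp_coeff_entire: "entire_coeffs (exp_coeff M)"
proof -
  obtain K where K: "\<And>x :: complex^'a^'a. norm (M ** x) \<le> norm x * K"
    using bounded_linear.bounded[OF bounded_linear_matrix_mult_left] by blast
  have "norm (exp_coeff M (Suc n)) * real (Suc n) \<le> K * norm (exp_coeff M n)" for n
    using K[of "exp_coeff M n"] unfolding exp_coeff_Suc[symmetric] norm_scaleR
    by (simp add: mult.commute del: of_nat_Suc)
  then show ?thesis by (rule entire_coeffs_ratio)
qed

lemma matrix_exp_eq_power_series: "matrix_exp (s *\<^sub>R M) = power_series (exp_coeff M) s"
  by (simp add: matrix_exp_def power_series_def matrix_pow_scaleR exp_coeff_def mult.commute)

lemma has_vector_derivative_matrix_exp:
  "((\<lambda>s. matrix_exp (s *\<^sub>R M)) has_vector_derivative M ** matrix_exp (s *\<^sub>R M)) (at s)"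
proof -
  have "deriv_coeffs (exp_coeff M) = (\<lambda>n. M ** exp_coeff M n)"
    by (simp only: deriv_coeffs_def[abs_def] exp_coeff_Suc)
  then show ?thesis
    using has_vector_derivative_power_series[OF exp_coeff_entire, of M s]
    by (simp add: matrix_exp_eq_power_series power_series_bounded_linear(2)[OF bounded_linear_matrix_mult_left exp_coeff_entire])
qed

lemma matrix_exp_0: "matrix_exp (0 *\<^sub>R M) = mat 1"
  unfolding matrix_exp_eq_power_series power_series_0 by (simp add: exp_coeff_def)

text \<open>The orientation fits the time \<open>s = - ln t \<ge> 0\<close> for
  \<open>0 < t \<le> 1\<close>, since decay and uniqueness are stated for nonnegative times.\<close>

lemma matrix_exp_minus_deriv:
  "((\<lambda>s. matrix_exp ((- s) *\<^sub>R M)) has_vector_derivative - (M ** matrix_exp ((- s) *\<^sub>R M))) (at s)"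
  using has_vector_derivative_matrix_exp[of "- M" s]
  by (simp add: linear_neg[OF linear_matrix_mult_right])

text \<open>In the time \<open>s = - ln t\<close> both sides solve the same linear equation with
  value \<open>mat 1\<close> at \<open>s = 0\<close>. The bound \<open>t \<le> 1\<close> keeps
  \<open>s\<close> nonnegative.\<close>

lemma real_matrix_powr_add_one:
  fixes M :: "complex^'r^'r"
  assumes "0 < t" "t \<le> 1"
  shows "real_matrix_powr t (M + mat 1) = t *\<^sub>R real_matrix_powr t M"
proof -
  define u where "u s = exp (- s) *\<^sub>R matrix_exp ((- s) *\<^sub>R M)" for s :: real
  have lin: "bounded_linear (\<lambda>x. - ((M + mat 1) ** x))"
    by (intro bounded_linear_minus) (rule bounded_linear_matrix_mult_left)
  have "matrix_exp ((- s) *\<^sub>R (M + mat 1)) = u s" if "s \<ge> 0" for s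
  proof (rule linear_ode_unique[OF lin _ _ _ that])
    fix x :: real
    show "((\<lambda>s. matrix_exp ((- s) *\<^sub>R (M + mat 1))) has_vector_derivative
        - ((M + mat 1) ** matrix_exp ((- x) *\<^sub>R (M + mat 1)))) (at x)"
      by (rule matrix_exp_minus_deriv)
    have "((\<lambda>s. exp (- s)) has_real_derivative - exp (- x)) (at x)"
      by (auto intro!: derivative_eq_intros)
    then have "(u has_vector_derivative exp (- x) *\<^sub>R - (M ** matrix_exp ((- x) *\<^sub>R M)) +
        (- exp (- x)) *\<^sub>R matrix_exp ((- x) *\<^sub>R M)) (at x)"
      unfolding u_def[abs_def] by (intro has_vector_derivative_scaleR matrix_exp_minus_deriv)
    moreover have "exp (- x) *\<^sub>R - (M ** matrix_exp ((- x) *\<^sub>R M)) +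
        (- exp (- x)) *\<^sub>R matrix_exp ((- x) *\<^sub>R M) = - ((M + mat 1) ** u x)"
      by (simp add: u_def linear_scale[OF linear_matrix_mult_left] linear_add[OF linear_matrix_mult_right]
          scaleR_add_right)
    ultimately show "(u has_vector_derivative - ((M + mat 1) ** u x)) (at x)" by simp
    show "matrix_exp ((- 0) *\<^sub>R (M + mat 1)) = u 0"
      using matrix_exp_0[of "M + mat 1"] matrix_exp_0[of M] by (simp add: u_def)
  qed
  from this[of "- ln t"] show ?thesis
    using assms by (simp add: u_def real_matrix_powr_def)
qed

lemma lyapunov_accretive_matrix_mult_left:
  fixes A :: "complex^'a^'a"
  assumes "positive_stable A"
  shows "lyapunov_accretive ((**) A :: complex^'a^'a \<Rightarrow> complex^'a^'a)"
proof (rule lyapunov_accretive_lift[OF lyapunov_accretive_positive_stable[OF assms],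
      where I = UNIV and \<pi> = "\<lambda>j x. \<chi> i. x $ i $ j"])
  show "bounded_linear (\<lambda>x::complex^'a^'a. \<chi> i. x $ i $ j)" for j
    by (rule linearI[THEN linear_conv_bounded_linear[THEN iffD1]]) (simp_all add: vec_eq_iff)
  show "(norm x)\<^sup>2 = (\<Sum>j\<in>UNIV. (norm (\<chi> i. x $ i $ j))\<^sup>2)" for x :: "complex^'a^'a"
    unfolding norm_vec_sq by (subst sum.swap) simp
qed (auto simp: vec_eq_iff matrix_vector_mult_def matrix_matrix_mult_def)

text \<open>As \<open>M - mat 1\<close> need not be positive stable, the decay lemma is applied to
  \<open>M\<close>: \<open>exp (- d * s)\<close> at \<open>s = - ln t\<close> is
  \<open>t powr d\<close>, and passing to \<open>M - mat 1\<close> costs one factor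
  \<open>t\<close>.\<close>

lemma real_matrix_powr_bound:
  fixes M :: "complex^'r^'r"
  assumes "positive_stable M"
  obtains d C where "d > 0" "C \<ge> 0"
    "\<And>t. 0 < t \<Longrightarrow> t \<le> 1 \<Longrightarrow> norm (real_matrix_powr t (M - mat 1)) \<le> C * t powr (d - 1)"
proof -
  obtain d C where Cd: "d > 0" "C \<ge> 0"
    "\<And>u t. (\<And>x. x \<ge> 0 \<Longrightarrow> (u has_vector_derivative - (M ** u x)) (at x)) \<Longrightarrow> t \<ge> 0 \<Longrightarrow>
       norm (u t :: complex^'r^'r) \<le> C * exp (- d * t) * norm (u 0)"
    by (fact lyapunov_accretive_decay[OF lyapunov_accretive_matrix_mult_left[OF assms]])
  let ?I = "norm (mat 1 :: complex^'r^'r)"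
  show ?thesis
  proof (rule that[of d "C * ?I"])
    fix t :: real assume t: "0 < t" "t \<le> 1"
    have "norm (real_matrix_powr t M) \<le> C * exp (- d * (- ln t)) * ?I"
      using Cd(3)[OF matrix_exp_minus_deriv, of "- ln t"] t matrix_exp_0[of M]
      by (simp add: real_matrix_powr_def)
    also have "exp (- d * (- ln t)) = t * t powr (d - 1)"
      using t by (simp add: powr_def exp_diff left_diff_distrib)
    finally have "norm (t *\<^sub>R real_matrix_powr t (M - mat 1)) \<le> t * (C * ?I * t powr (d - 1))"
      using real_matrix_powr_add_one[OF t, of "M - mat 1"] by (simp add: mult_ac)
    then show "norm (real_matrix_powr t (M - mat 1)) \<le> C * ?I * t powr (d - 1)"
      using t by simp
  qed (use Cd in auto)
qed

section \<open>Integrability of the beta integrand and the functional relation\<close>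

lemma continuous_on_real_matrix_powr:
  assumes "continuous_on S f" "\<And>x. x \<in> S \<Longrightarrow> 0 < f x"
  shows "continuous_on S (\<lambda>x. real_matrix_powr (f x) M)"
proof -
  have "continuous_on S (\<lambda>x. power_series (exp_coeff M) (ln (f x)))"
    by (rule continuous_on_compose2[OF continuous_on_power_series[OF exp_coeff_entire]])
      (use assms in \<open>auto intro!: continuous_on_ln less_imp_neq[symmetric]\<close>)
  then show ?thesis by (simp add: real_matrix_powr_def matrix_exp_eq_power_series)
qed

theorem theorem3p3:
  fixes A B X Y Z :: "complex^'r^'r"
  assumes "positive_stable A" and "positive_stable B"
    and "positive_stable X" and "positive_stable Y" and "positive_stable Z"
  shows "extended_beta A B Y (X + mat 1) Z + extended_beta A B Y X (Z + mat 1)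
       = extended_beta A B Y X Z"
proof -
  define \<Phi> where "\<Phi> t = matrix_1F1 A B (- ((1 / (t * (1 - t))) *\<^sub>R Y))" for t :: real
  define F where "F t = \<Phi> t ** real_matrix_powr t (X - mat 1) ** real_matrix_powr (1 - t) (Z - mat 1)" for t
  obtain C0 where C0: "\<And>s. s \<ge> 0 \<Longrightarrow> norm (matrix_1F1 A B (- (s *\<^sub>R Y))) \<le> C0"
    using matrix_1F1_bounded[OF assms(1,2,4)] by blast
  obtain d1 C1 where X: "d1 > 0" "C1 \<ge> 0"
    "\<And>t. 0 < t \<Longrightarrow> t \<le> 1 \<Longrightarrow> norm (real_matrix_powr t (X - mat 1)) \<le> C1 * t powr (d1 - 1)"
    by (fact real_matrix_powr_bound[OF assms(3)])
  obtain d2 C2 where Z: "d2 > 0" "C2 \<ge> 0"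
    "\<And>t. 0 < t \<Longrightarrow> t \<le> 1 \<Longrightarrow> norm (real_matrix_powr t (Z - mat 1)) \<le> C2 * t powr (d2 - 1)"
    by (fact real_matrix_powr_bound[OF assms(5)])
  obtain K where K: "K > 0" "\<And>(P :: complex^'r^'r) (Q :: complex^'r^'r). norm (P ** Q) \<le> norm P * norm Q * K"
    using bounded_bilinear.pos_bounded[OF bounded_bilinear_matrix_mult] by blast
  have C0_nonneg: "C0 \<ge> 0" using C0[of 0] norm_ge_zero order_trans by blast
  \<comment> \<open>A multiple of the Beta integrand, integrable because \<open>d1\<close> and
    \<open>d2\<close> are positive; \<open>K^2\<close> comes from the two matrix products in
    \<open>F\<close>.\<close>
  define G where "G t = C0 * C1 * C2 * K\<^sup>2 * (t powr (d1 - 1) * (1 - t) powr (d2 - 1))" for t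
  have F_bound: "norm (F t) \<le> G t" if t: "t \<in> {0<..<1}" for t
  proof -
    have "norm (F t) \<le> norm (\<Phi> t ** real_matrix_powr t (X - mat 1)) * norm (real_matrix_powr (1 - t) (Z - mat 1)) * K"
      unfolding F_def by (rule K)
    also have "\<dots> \<le> (norm (\<Phi> t) * norm (real_matrix_powr t (X - mat 1)) * K) * norm (real_matrix_powr (1 - t) (Z - mat 1)) * K"
      using K by (intro mult_right_mono) auto
    also have "\<dots> \<le> (C0 * (C1 * t powr (d1 - 1)) * K) * (C2 * (1 - t) powr (d2 - 1)) * K"
      using K X Z C0_nonneg t by (intro mult_mono mult_nonneg_nonneg) (auto simp: \<Phi>_def C0)
    finally show ?thesis by (simp add: G_def power2_eq_square mult_ac)
  qed
  have F_cont: "continuous_on {0<..<1} F"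
    unfolding F_def \<Phi>_def
    by (intro bounded_bilinear.continuous_on[OF bounded_bilinear_matrix_mult] continuous_on_real_matrix_powr
        continuous_on_compose2[OF continuous_on_matrix_1F1[OF assms(1,2,4), of UNIV]] continuous_intros) auto
  have "(\<lambda>t. t powr (d1 - 1) * (1 - t) powr (d2 - 1)) integrable_on {0<..<1::real}"
    using has_integral_Beta_real[OF X(1) Z(1)] by (auto simp: has_integral_Icc_iff_Ioo)
  from integrable_cmul[OF this, of "C0 * C1 * C2 * K\<^sup>2"] have G: "G integrable_on {0<..<1}"
    by (simp only: G_def[abs_def] real_scaleR_def)
  \<comment> \<open>The weight \<open>h\<close> covers both \<open>t\<close> and
    \<open>1 - t\<close>: continuity gives measurability, and \<open>G\<close> dominates.\<close>
  have int: "(\<lambda>t. h t *\<^sub>R F t) integrable_on {0<..<1}"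
    if h: "continuous_on {0<..<1} h" "\<And>t. t \<in> {0<..<1} \<Longrightarrow> \<bar>h t\<bar> \<le> 1" for h :: "real \<Rightarrow> real"
  proof (rule set_lebesgue_integral_eq_integral(1)
      [OF measurable_bounded_by_integrable_imp_absolutely_integrable[OF _ _ G]])
    show "(\<lambda>t. h t *\<^sub>R F t) \<in> borel_measurable (lebesgue_on {0<..<1})"
      by (intro continuous_imp_measurable_on_sets_lebesgue continuous_on_scaleR h F_cont) auto
    show "norm (h t *\<^sub>R F t) \<le> G t" if "t \<in> {0<..<1}" for t
      using mult_mono[OF h(2)[OF that] F_bound[OF that]] by simp
  qed auto
  \<comment> \<open>The exponent \<open>X + mat 1 - mat 1\<close> is read as
    \<open>(X - mat 1) + mat 1\<close>, which releases a scalar \<open>t\<close> that passes through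
    the matrix products.\<close>
  have "extended_beta A B Y (X + mat 1) Z = integral {0<..<1} (\<lambda>t. t *\<^sub>R F t)"
    unfolding extended_beta_def
  proof (rule integral_cong)
    fix t :: real assume "t \<in> {0<..<1}"
    then show "matrix_1F1 A B (- ((1 / (t * (1 - t))) *\<^sub>R Y)) ** real_matrix_powr t (X + mat 1 - mat 1) **
        real_matrix_powr (1 - t) (Z - mat 1) = t *\<^sub>R F t"
      using real_matrix_powr_add_one[of t "X - mat 1"]
      by (simp add: F_def \<Phi>_def linear_scale[OF linear_matrix_mult_left] linear_scale[OF linear_matrix_mult_right])
  qed
  moreover have "extended_beta A B Y X (Z + mat 1) = integral {0<..<1} (\<lambda>t. (1 - t) *\<^sub>R F t)"
    unfolding extended_beta_def
  proof (rule integral_cong)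
    fix t :: real assume "t \<in> {0<..<1}"
    then show "matrix_1F1 A B (- ((1 / (t * (1 - t))) *\<^sub>R Y)) ** real_matrix_powr t (X - mat 1) **
        real_matrix_powr (1 - t) (Z + mat 1 - mat 1) = (1 - t) *\<^sub>R F t"
      using real_matrix_powr_add_one[of "1 - t" "Z - mat 1"]
      by (simp add: F_def \<Phi>_def linear_scale[OF linear_matrix_mult_left] linear_scale[OF linear_matrix_mult_right])
  qed
  \<comment> \<open>Both integrals must exist before they are added: \<open>integral\<close>
    defaults to 0 on functions that are not integrable, and additivity could then fail.\<close>
  moreover have "(\<lambda>t. t *\<^sub>R F t) integrable_on {0<..<1}" "(\<lambda>t. (1 - t) *\<^sub>R F t) integrable_on {0<..<1}"
    by (rule int; auto intro!: continuous_intros)+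
  ultimately have "extended_beta A B Y (X + mat 1) Z + extended_beta A B Y X (Z + mat 1) =
      integral {0<..<1} (\<lambda>t. t *\<^sub>R F t + (1 - t) *\<^sub>R F t)"
    by (simp add: integral_add)
  also have "\<dots> = extended_beta A B Y X Z"
    by (simp add: scaleR_add_left[symmetric] extended_beta_def F_def \<Phi>_def)
  finally show ?thesis .
qed

end
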